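(* Let $\delta_A=(d_A,T_A)$ be the changepoint detection--identification rule with positive thresholds $A=(A_{ij})$, $i\in\mathcal N$, $j\in\mathcal N_0\setminus\{i\}$, defined in the context. Then the following upper bounds hold: $$\mathsf{PFA}_i^\pi(\delta_A)\le \frac{1}{1+A_{i0}},\quad i\in\mathcal N,\qquad \mathsf{PFA}^\pi(\delta_A)\le\sum_{i=1}^N\frac{1}{1+A_{i0}},$$ and $$\mathsf{PMI}_{ij}^\pi(\delta_A)\le\frac{1+A_{i0}}{A_{i0}\,A_{ji}},\quad i,j\in\mathcal N,\ i\ne j,\qquad \mathsf{PMI}_i^\pi(\delta_A)\le\frac{1+A_{i0}}{A_{i0}}\sum_{j\in\mathcal N\setminus\{i\}}\frac1{A_{ji}},\quad i\in\mathcal N.$$ Thus, if $\alpha_{\max}=\max_{i\in\mathcal N}\alpha_i<1-\pi_{-1}$, then $$A_{i0}=\frac{1-\alpha_i}{\alpha_i}\ (i\in\mathcal N)\quad\text{and}\quad A_{ij}=\frac{1}{(1-\alpha_j)\beta_{ji}}\ (i,j\in\mathcal N,\ i\neq j)\quad\text{imply}\quad\delta_A\in\mathbb C_\pi(\boldsymbol\alpha,\boldsymbol\beta),$$ and if $A_{i0}=A_0$ for $i\in\mathcal N$ and $A_{ij}=A_j$ for $i\in\mathcal N$, $j\in\mathcal N\setminus\{i\}$, then $$A_0=\frac N\alpha\Big(1-\frac{\alpha}{N}\Big)\quad\text{and}\quad A_j=\frac{N-1}{(1-\alpha/N)\bar\beta_j}\ (j\in\mathcal N)\quad\text{imply}\quad\delta_A\in\mathbb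 C_\pi^\star(\alpha,\bar{\boldsymbol\beta}).$$
   Context: Model. $N\ge2$, $\mathcal N=\{1,\dots,N\}$, $\mathcal N_0=\{0,1,\dots,N\}$. There are $N$ independent data streams $\{X_n(i)\}_{n\ge1}$, $i\in\mathcal N$; $\mathbf X^n(i)=(X_1(i),\dots,X_n(i))$, $\mathbf X^n=(\mathbf X^n(1),\dots,\mathbf X^n(N))$, $\mathcal F_n=\sigma(\mathbf X^n)$. For each stream $i$, $g_i(X_t(i)|\mathbf X^{t-1}(i))$ and $f_{i,\theta_i}(X_t(i)|\mathbf X^{t-1}(i))$, $\theta_i\in\Theta_i$ ($\Theta_i$ a subset of a Euclidean space), are conditional pre- and post-change densities with respect to a sigma-finite measure. Under $\mathsf P_\infty$ (no change) $\mathbf X^n$ has density $\prod_{t=1}^n\prod_{\ell=1}^N g_\ell(X_t(\ell)|\mathbf X^{t-1}(\ell))$ for all $n$. Under $\mathsf P_{k,i,\theta_i}$ (change at $\nu=k$ in stream $i$ with parameter $\theta_i$), the density of $\mathbf X^n$ is the same as under $\mathsf P_\infty$ for $k\ge n$, and for $k<n$ it is $$\prod_{t=1}^{k}g_i(X_t(i)|\mathbf X^{t-1}(i))\prod_{t=k+1}^n f_{i,\theta_i}(X_t(i)|\mathbf X^{t-1}(i))\prod_{j\in\mathcal N\setminus\{i\}}\prod_{t=1}^n g_j(X_t(j)|\mathbf X^{t-1}(j));$$ $\mathsf P_{-1,i,\theta_i}$ coincides with $\mathsf P_{0,i,\theta_i}$. Prior. The change point $\nu$ takes values in $\{-1,0,1,\dots\}$,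 independently of the observations, with $\pi_k=\mathsf P(\nu=k)$, $\pi_k>0$ for $k\ge0$, $\pi_{-1}\in[0,1)$, $\sum_{k\ge-1}\pi_k=1$. Put $\mathsf P^\pi_{i,\theta_i}(\mathcal A\times\mathcal K)=\sum_{k\in\mathcal K}\pi_k\mathsf P_{k,i,\theta_i}(\mathcal A)$. Statistics. For $-1\le k<n$, $LR_{i,\theta_i}(k,n)=\prod_{t=k+1}^n\mathcal L_{i,\theta_i}(t)$ with $\mathcal L_{i,\theta_i}(t)=f_{i,\theta_i}(X_t(i)|\mathbf X^{t-1}(i))/g_i(X_t(i)|\mathbf X^{t-1}(i))$ for $t\ge 1$ and $\mathcal L_{i,\theta_i}(0)=1$. $W_i$ is a probability (mixing) measure on $\Theta_i$ such that $W_i\{\vartheta\in\Theta_i:|\vartheta-\theta_i|<\varkappa\}>0$ for all $\varkappa>0$, $\theta_i\in\Theta_i$. For $n\ge1$, $$\Lambda^\pi_{i,W}(n)=\sum_{k=-1}^{n-1}\pi_k\int_{\Theta_i}LR_{i,\theta_i}(k,n)\,dW_i(\theta_i),$$ $$\bar\Lambda_{ij}^{\pi,W}(n)=\frac{\Lambda_{i,W}^\pi(n)}{\sum_{k=-1}^{n-1}\pi_k\sup_{\theta_j\in\Theta_j}LR_{j,\theta_j}(k,n)}\ (i,j\in\mathcal N,\,i\ne j),\qquad \bar\Lambda_{i0}^{\pi,W}(n)=\frac{\Lambda_{i,W}^\pi(n)}{\mathsf P(\nu\ge n)}\ (i\in\mathcal N).$$ Rules. A detection--identification rule is a pair $\delta=(d,T)$,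 $T$ a stopping time with respect to $\{\mathcal F_n\}_{n\ge0}$ and $d\in\mathcal N$ a decision made at time $T$ (which stream has changed). The rule $\delta_A=(d_A,T_A)$ is: $T_A^{(i)}=\inf\{n\ge1:\bar\Lambda_{ij}^{\pi,W}(n)\ge A_{ij}\ \forall j\in\mathcal N_0\setminus\{i\}\}$ ($\inf\varnothing=\infty$), $T_A=\min_{\ell\in\mathcal N}T_A^{(\ell)}$, $d_A=i$ if $T_A=T_A^{(i)}$ (ties broken arbitrarily). Error probabilities. $\mathsf{PFA}^\pi(\delta)=\mathsf P^\pi_{i,\theta_i}(T\le\nu)=\sum_{k=0}^\infty\pi_k\mathsf P_\infty(T\le k)$; $\mathsf{PFA}_i^\pi(\delta)=\sum_{k=0}^\infty\pi_k\mathsf P_\infty(T\le k,\,d=i)$; $\mathsf{PMI}_{ij}^\pi(\delta)=\sup_{\theta_i\in\Theta_i}\mathsf P^\pi_{i,\theta_i}(d=j,\,T<\infty\,|\,T>\nu)$ for $i\ne j$ in $\mathcal N$; $\mathsf{PMI}_i^\pi(\delta)=\sup_{\theta_i\in\Theta_i}\mathsf P^\pi_{i,\theta_i}(d\ne i,\,T<\infty\,|\,T>\nu)$. Classes. For $\boldsymbol\alpha=(\alpha_i)_{i\in\mathcal N}$, $\boldsymbol\beta=(\beta_{ij})_{i\neq j}$, $\bar{\boldsymbol\beta}=(\bar\beta_i)_{i\in\mathcal N}$ and $\alpha$, all entries in $(0,1)$: $\mathbb C_\pi(\boldsymbol\alpha,\boldsymbol\beta)=\{\delta:\mathsf{PFA}_i^\pi(\delta)\le\alpha_i\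 \forall i\in\mathcal N,\ \mathsf{PMI}_{ij}^\pi(\delta)\le\beta_{ij}\ \forall i\ne j\in\mathcal N\}$ and $\mathbb C_\pi^\star(\alpha,\bar{\boldsymbol\beta})=\{\delta:\mathsf{PFA}^\pi(\delta)\le\alpha,\ \mathsf{PMI}_i^\pi(\delta)\le\bar\beta_i\ \forall i\in\mathcal N\}$. *)

theory Defs
  imports "HOL-Probability.Probability"
begin

text \<open>
  Streams are indexed by \<open>1, \<dots>, N\<close>, times by \<open>1, 2, \<dots>\<close>. The history \<open>h\<close> passed to
  \<open>pre_dens m i t h x\<close> and \<open>post_dens m i \<theta> t h x\<close> is a function on \<open>{1..<t}\<close>, so these are the conditional
  densities at \<open>x\<close> of the \<open>t\<close>-th observation of stream \<open>i\<close> given its first \<open>t - 1\<close> observations.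
  All \<open>Param m i\<close> live in one Euclidean space, into which parameter spaces of smaller dimension embed.
  The law \<open>Pch m k i \<theta>\<close> is indexed by \<open>k \<ge> 0\<close> only; the convention that change point \<open>-1\<close> has the
  same law as change point \<open>0\<close> is built into \<open>Ppi\<close> below through \<open>nat k\<close>.
\<close>

record ('w, 'x, 'e) cp_model =
  nstreams :: nat
  Obs :: "nat \<Rightarrow> nat \<Rightarrow> 'w \<Rightarrow> 'x"            (* stream, time *)
  Ref :: "nat \<Rightarrow> 'x measure"
  pre_dens :: "nat \<Rightarrow> nat \<Rightarrow> (nat \<Rightarrow> 'x) \<Rightarrow> 'x \<Rightarrow> real"
  post_dens :: "nat \<Rightarrow> 'e \<Rightarrow> nat \<Rightarrow> (nat \<Rightarrow> 'x) \<Rightarrow> 'x \<Rightarrow> real"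
  Param :: "nat \<Rightarrow> 'e set"
  Pinf :: "'w measure"
  Pch :: "nat \<Rightarrow> nat \<Rightarrow> 'e \<Rightarrow> 'w measure"     (* change point, stream, parameter *)
  prior :: "int pmf"
  Mix :: "nat \<Rightarrow> 'e measure"

definition stream_ids :: "('w, 'x, 'e) cp_model \<Rightarrow> nat set" where
  "stream_ids m = {1..nstreams m}"

definition hist_space :: "('w, 'x, 'e) cp_model \<Rightarrow> nat \<Rightarrow> nat set \<Rightarrow> (nat \<Rightarrow> 'x) measure" where
  "hist_space m i I = PiM I (\<lambda>_. Ref m i)"

definition obs_space :: "('w, 'x, 'e) cp_model \<Rightarrow> nat \<Rightarrow> (nat \<Rightarrow> nat \<Rightarrow> 'x) measure" where
  "obs_space m n = PiM (stream_ids m) (\<lambda>i. hist_space m i {1..n})"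

definition obs_vec :: "('w, 'x, 'e) cp_model \<Rightarrow> nat \<Rightarrow> 'w \<Rightarrow> nat \<Rightarrow> nat \<Rightarrow> 'x" where
  "obs_vec m n \<omega> = (\<lambda>i\<in>stream_ids m. \<lambda>t\<in>{1..n}. Obs m i t \<omega>)"

definition pre_at :: "('w, 'x, 'e) cp_model \<Rightarrow> nat \<Rightarrow> nat \<Rightarrow> (nat \<Rightarrow> 'x) \<Rightarrow> real" where
  "pre_at m i t x = pre_dens m i t (restrict x {1..<t}) (x t)"

definition post_at :: "('w, 'x, 'e) cp_model \<Rightarrow> nat \<Rightarrow> 'e \<Rightarrow> nat \<Rightarrow> (nat \<Rightarrow> 'x) \<Rightarrow> real" where
  "post_at m i \<theta> t x = post_dens m i \<theta> t (restrict x {1..<t}) (x t)"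

definition dens_inf :: "('w, 'x, 'e) cp_model \<Rightarrow> nat \<Rightarrow> (nat \<Rightarrow> nat \<Rightarrow> 'x) \<Rightarrow> real" where
  "dens_inf m n y = (\<Prod>t\<in>{1..n}. \<Prod>l\<in>stream_ids m. pre_at m l t (y l))"

definition dens_ch ::
  "('w, 'x, 'e) cp_model \<Rightarrow> nat \<Rightarrow> nat \<Rightarrow> 'e \<Rightarrow> nat \<Rightarrow> (nat \<Rightarrow> nat \<Rightarrow> 'x) \<Rightarrow> real" where
  "dens_ch m k i \<theta> n y =
    (if n \<le> k then dens_inf m n y
     else (\<Prod>t\<in>{1..k}. pre_at m i t (y i)) * (\<Prod>t\<in>{k+1..n}. post_at m i \<theta> t (y i)) *
          (\<Prod>j\<in>stream_ids m - {i}. \<Prod>t\<in>{1..n}. pre_at m j t (y j)))"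

locale changepoint_model =
  fixes m :: "('w, 'x, 'e :: euclidean_space) cp_model"
  assumes nstreams_ge2: "nstreams m \<ge> 2"
    and sigma_finite_Ref: "\<And>i. i \<in> stream_ids m \<Longrightarrow> sigma_finite_measure (Ref m i)"
    and pre_nonneg: "\<And>i t h x. i \<in> stream_ids m \<Longrightarrow> t \<ge> 1 \<Longrightarrow> h \<in> space (hist_space m i {1..<t}) \<Longrightarrow>
          x \<in> space (Ref m i) \<Longrightarrow> pre_dens m i t h x \<ge> 0"
    and pre_measurable: "\<And>i t. i \<in> stream_ids m \<Longrightarrow> t \<ge> 1 \<Longrightarrow>
          (\<lambda>(h, x). pre_dens m i t h x) \<in> borel_measurable (hist_space m i {1..<t} \<Otimes>\<^sub>M Ref m i)"
    and pre_density: "\<And>i t h. i \<in> stream_ids m \<Longrightarrow> t \<ge> 1 \<Longrightarrow> h \<in> space (hist_space m i {1..<t}) \<Longrightarrow>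
          (\<integral>\<^sup>+ x. ennreal (pre_dens m i t h x) \<partial>Ref m i) = 1"
    and post_nonneg: "\<And>i \<theta> t h x. i \<in> stream_ids m \<Longrightarrow> \<theta> \<in> Param m i \<Longrightarrow> t \<ge> 1 \<Longrightarrow>
          h \<in> space (hist_space m i {1..<t}) \<Longrightarrow> x \<in> space (Ref m i) \<Longrightarrow> post_dens m i \<theta> t h x \<ge> 0"
    and post_measurable: "\<And>i t. i \<in> stream_ids m \<Longrightarrow> t \<ge> 1 \<Longrightarrow>
          (\<lambda>(\<theta>, h, x). post_dens m i \<theta> t h x) \<in> borel_measurable
            (restrict_space borel (Param m i) \<Otimes>\<^sub>M (hist_space m i {1..<t} \<Otimes>\<^sub>M Ref m i))"
    and post_density: "\<And>i \<theta> t h. i \<in> stream_ids m \<Longrightarrow> \<theta> \<in> Param m i \<Longrightarrow> t \<ge> 1 \<Longrightarrow>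
          h \<in> space (hist_space m i {1..<t}) \<Longrightarrow>
          (\<integral>\<^sup>+ x. ennreal (post_dens m i \<theta> t h x) \<partial>Ref m i) = 1"
    and prob_space_Pinf: "prob_space (Pinf m)"
    and prob_space_Pch: "\<And>k i \<theta>. i \<in> stream_ids m \<Longrightarrow> \<theta> \<in> Param m i \<Longrightarrow> prob_space (Pch m k i \<theta>)"
    and sets_Pch: "\<And>k i \<theta>. i \<in> stream_ids m \<Longrightarrow> \<theta> \<in> Param m i \<Longrightarrow> sets (Pch m k i \<theta>) = sets (Pinf m)"
    and law_Pinf: "\<And>n. distributed (Pinf m) (obs_space m n) (obs_vec m n)
          (\<lambda>y. ennreal (dens_inf m n y))"
    and law_Pch: "\<And>k i \<theta> n. i \<in> stream_ids m \<Longrightarrow> \<theta> \<in> Param m i \<Longrightarrow>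
          distributed (Pch m k i \<theta>) (obs_space m n) (obs_vec m n)
          (\<lambda>y. ennreal (dens_ch m k i \<theta> n y))"
    and prior_support: "set_pmf (prior m) \<subseteq> {-1..}"
    and prior_pos: "\<And>k. k \<ge> 0 \<Longrightarrow> pmf (prior m) k > 0"
    and prior_minus1: "pmf (prior m) (-1) < 1"
    and prob_space_Mix: "\<And>i. i \<in> stream_ids m \<Longrightarrow> prob_space (Mix m i)"
    and sets_Mix: "\<And>i. i \<in> stream_ids m \<Longrightarrow> sets (Mix m i) = sets (restrict_space borel (Param m i))"
    and Mix_ball: "\<And>i \<theta> r. i \<in> stream_ids m \<Longrightarrow> \<theta> \<in> Param m i \<Longrightarrow> r > 0 \<Longrightarrow>
          measure (Mix m i) {\<theta>' \<in> Param m i. norm (\<theta>' - \<theta>) < r} > 0"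

text \<open>Law of the pair (observations, change point) on \<open>\<Omega> \<times> {-1, 0, 1, \<dots>}\<close>.\<close>

definition Ppi :: "('w, 'x, 'e) cp_model \<Rightarrow> nat \<Rightarrow> 'e \<Rightarrow> ('w \<times> int) measure" where
  "Ppi m i \<theta> = measure_pmf (prior m) \<bind>
     (\<lambda>k. distr (Pch m (nat k) i \<theta>) (Pinf m \<Otimes>\<^sub>M count_space UNIV) (\<lambda>\<omega>. (\<omega>, k)))"

text \<open>
  Likelihood ratios and the statistics built from them take values in \<open>[0, \<infinity>]\<close>, so that \<open>c / 0 = \<infinity>\<close>
  for \<open>c > 0\<close>, while \<open>0 / 0 = 0\<close> and \<open>\<infinity> / \<infinity> = 0\<close>.
\<close>

definition lr1 :: "('w, 'x, 'e) cp_model \<Rightarrow> nat \<Rightarrow> 'e \<Rightarrow> nat \<Rightarrow> 'w \<Rightarrow> ennreal" where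
  "lr1 m i \<theta> t \<omega> = (if t = 0 then 1 else
     ennreal (post_at m i \<theta> t (\<lambda>s. Obs m i s \<omega>)) / ennreal (pre_at m i t (\<lambda>s. Obs m i s \<omega>)))"

definition LR :: "('w, 'x, 'e) cp_model \<Rightarrow> nat \<Rightarrow> 'e \<Rightarrow> int \<Rightarrow> nat \<Rightarrow> 'w \<Rightarrow> ennreal" where
  "LR m i \<theta> k n \<omega> = (\<Prod>t\<in>{nat (k + 1)..n}. lr1 m i \<theta> t \<omega>)"

definition Lam :: "('w, 'x, 'e) cp_model \<Rightarrow> nat \<Rightarrow> nat \<Rightarrow> 'w \<Rightarrow> ennreal" where
  "Lam m i n \<omega> = (\<Sum>k\<in>{-1..int n - 1}. ennreal (pmf (prior m) k) * (\<integral>\<^sup>+ \<theta>. LR m i \<theta> k n \<omega> \<partial>Mix m i))"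

definition Lambar :: "('w, 'x, 'e) cp_model \<Rightarrow> nat \<Rightarrow> nat \<Rightarrow> nat \<Rightarrow> 'w \<Rightarrow> ennreal" where
  "Lambar m i j n \<omega> = Lam m i n \<omega> /
     (if j = 0 then ennreal (measure_pmf.prob (prior m) {int n..})
      else (\<Sum>k\<in>{-1..int n - 1}. ennreal (pmf (prior m) k) * (SUP \<theta>\<in>Param m j. LR m j \<theta> k n \<omega>)))"

definition Fn :: "('w, 'x, 'e) cp_model \<Rightarrow> nat \<Rightarrow> 'w measure" where
  "Fn m n = vimage_algebra (space (Pinf m)) (obs_vec m n) (obs_space m n)"

text \<open>The value at \<open>\<infinity>\<close> makes this a filtration indexed by the range of a stopping time.\<close>

definition Filt :: "('w, 'x, 'e) cp_model \<Rightarrow> enat \<Rightarrow> 'w measure" where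
  "Filt m t = (case t of enat n \<Rightarrow> Fn m n
     | \<infinity> \<Rightarrow> sigma (space (Pinf m)) (\<Union>n. sets (Fn m n)))"

type_synonym 'w rule = "('w \<Rightarrow> nat) \<times> ('w \<Rightarrow> enat)"

definition di_rule :: "('w, 'x, 'e) cp_model \<Rightarrow> 'w rule \<Rightarrow> bool" where
  "di_rule m = (\<lambda>(d, T). stopping_time (Filt m) T \<and>
     d \<in> measurable (filtration.pre_sigma (space (Pinf m)) (Filt m) T) (count_space (stream_ids m)))"

definition T_thr ::
  "('w, 'x, 'e) cp_model \<Rightarrow> (nat \<Rightarrow> nat \<Rightarrow> real) \<Rightarrow> nat \<Rightarrow> 'w \<Rightarrow> enat" where
  "T_thr m A i \<omega> =
     Inf {enat n | n. n \<ge> 1 \<and> (\<forall>j\<in>insert 0 (stream_ids m) - {i}. Lambar m i j n \<omega> \<ge> ennreal (A i j))}"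

text \<open>Several rules satisfy this when ties occur, one for each measurable way of breaking them.\<close>

definition threshold_rule ::
  "('w, 'x, 'e) cp_model \<Rightarrow> (nat \<Rightarrow> nat \<Rightarrow> real) \<Rightarrow> 'w rule \<Rightarrow> bool" where
  "threshold_rule m A = (\<lambda>(d, T). di_rule m (d, T) \<and>
     (\<forall>\<omega>\<in>space (Pinf m). T \<omega> = (MIN l\<in>stream_ids m. T_thr m A l \<omega>) \<and> T \<omega> = T_thr m A (d \<omega>) \<omega>))"

definition PFA :: "('w, 'x, 'e) cp_model \<Rightarrow> 'w rule \<Rightarrow> real" where
  "PFA m = (\<lambda>(d, T). \<Sum>k::nat. pmf (prior m) (int k) * \<P>(\<omega> in Pinf m. T \<omega> \<le> enat k))"

definition PFAi :: "('w, 'x, 'e) cp_model \<Rightarrow> 'w rule \<Rightarrow> nat \<Rightarrow> real" where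
  "PFAi m = (\<lambda>(d, T) i.
     \<Sum>k::nat. pmf (prior m) (int k) * \<P>(\<omega> in Pinf m. T \<omega> \<le> enat k \<and> d \<omega> = i))"

definition PMIij :: "('w, 'x, 'e) cp_model \<Rightarrow> 'w rule \<Rightarrow> nat \<Rightarrow> nat \<Rightarrow> real" where
  "PMIij m = (\<lambda>(d, T) i j. SUP \<theta>\<in>Param m i.
     \<P>(z in Ppi m i \<theta>. (d (fst z) = j \<and> T (fst z) < \<infinity>) \<bar>
        (ereal_of_enat (T (fst z)) > ereal (of_int (snd z)))))"

definition PMIi :: "('w, 'x, 'e) cp_model \<Rightarrow> 'w rule \<Rightarrow> nat \<Rightarrow> real" where
  "PMIi m = (\<lambda>(d, T) i. SUP \<theta>\<in>Param m i.
     \<P>(z in Ppi m i \<theta>. (d (fst z) \<noteq> i \<and> T (fst z) < \<infinity>) \<bar>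
        (ereal_of_enat (T (fst z)) > ereal (of_int (snd z)))))"

definition rule_class ::
  "('w, 'x, 'e) cp_model \<Rightarrow> (nat \<Rightarrow> real) \<Rightarrow> (nat \<Rightarrow> nat \<Rightarrow> real) \<Rightarrow> 'w rule set" where
  "rule_class m \<alpha> \<beta> = {\<delta>. di_rule m \<delta> \<and> (\<forall>i\<in>stream_ids m. PFAi m \<delta> i \<le> \<alpha> i) \<and>
     (\<forall>i\<in>stream_ids m. \<forall>j\<in>stream_ids m - {i}. PMIij m \<delta> i j \<le> \<beta> i j)}"

definition rule_class_star ::
  "('w, 'x, 'e) cp_model \<Rightarrow> real \<Rightarrow> (nat \<Rightarrow> real) \<Rightarrow> 'w rule set" where
  "rule_class_star m a b = {\<delta>. di_rule m \<delta> \<and> PFA m \<delta> \<le> a \<and> (\<forall>i\<in>stream_ids m. PMIi m \<delta> i \<le> b i)}"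

context changepoint_model
begin

lemma obs_vec_measurable: "obs_vec m n \<in> measurable (Pinf m) (obs_space m n)"
  using law_Pinf[of n] by (auto simp: distributed_def)

lemma sets_Fn_mono:
  assumes "n \<le> n'"
  shows "sets (Fn m n) \<subseteq> sets (Fn m n')"
proof -
  let ?r = "\<lambda>y. \<lambda>i\<in>stream_ids m. restrict (y i) {1..n}"
  have r: "?r \<in> measurable (obs_space m n') (obs_space m n)"
    unfolding obs_space_def hist_space_def using assms
    by (intro measurable_restrict measurable_compose[OF measurable_component_singleton]
        measurable_restrict_subset) auto
  have eq: "obs_vec m n \<omega> = ?r (obs_vec m n' \<omega>)" for \<omega>
    using assms by (auto simp: obs_vec_def fun_eq_iff restrict_def)
  have V: "obs_vec m n' \<in> measurable (Fn m n') (obs_space m n')"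
    unfolding Fn_def using obs_vec_measurable[of n'] by (intro measurable_vimage_algebra1) (auto dest: measurable_space)
  have "obs_vec m n \<in> measurable (Fn m n') (obs_space m n)"
    using measurable_compose[OF V r] unfolding eq[symmetric] .
  then show ?thesis
    by (auto simp: Fn_def[of m n] sets_vimage_algebra2 measurable_space[OF obs_vec_measurable]
        dest!: measurable_sets) (auto simp: Fn_def)
qed

lemma filtration_Filt: "filtration (space (Pinf m)) (Filt m)"
proof
  have sub: "(\<Union>n. sets (Fn m n)) \<subseteq> Pow (space (Pinf m))"
    using sets.space_closed[of "Fn m _"] by (auto simp: Fn_def)
  show "space (Filt m t) = space (Pinf m)" for t
    using sub by (cases t) (auto simp: Filt_def Fn_def space_measure_of)
  fix s t :: enat assume "s \<le> t"
  then show "sets (Filt m s) \<subseteq> sets (Filt m t)"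
    using sub sets_Fn_mono
    by (cases s; cases t) (auto simp: Filt_def sets_measure_of)
qed

lemma Ppi_kernel:
  assumes "i \<in> stream_ids m" "\<theta> \<in> Param m i"
  shows "(\<lambda>k. distr (Pch m (nat k) i \<theta>) (Pinf m \<Otimes>\<^sub>M count_space UNIV) (\<lambda>\<omega>. (\<omega>, k)))
    \<in> measurable (measure_pmf (prior m)) (subprob_algebra (Pinf m \<Otimes>\<^sub>M count_space UNIV))"
proof -
  have "prob_space (distr (Pch m (nat k) i \<theta>) (Pinf m \<Otimes>\<^sub>M count_space UNIV) (\<lambda>\<omega>. (\<omega>, k)))"
    for k :: int
    by (rule prob_space.prob_space_distr[OF prob_space_Pch[OF assms]])
       (unfold measurable_cong_sets[OF sets_Pch[OF assms] refl], simp)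
  then show ?thesis
    by (auto simp: space_subprob_algebra intro: prob_space_imp_subprob_space)
qed

lemma emeasure_Ppi:
  assumes "i \<in> stream_ids m" "\<theta> \<in> Param m i" "E \<in> sets (Pinf m \<Otimes>\<^sub>M count_space UNIV)"
  shows "emeasure (Ppi m i \<theta>) E =
    (\<integral>\<^sup>+ k. emeasure (Pch m (nat k) i \<theta>) ((\<lambda>\<omega>. (\<omega>, k)) -` E) \<partial>measure_pmf (prior m))"
proof -
  have sp: "space (Pch m k i \<theta>) = space (Pinf m)" for k
    using sets_Pch[OF assms(1,2)] by (rule sets_eq_imp_space_eq)
  have "E \<subseteq> space (Pinf m) \<times> UNIV"
    using sets.sets_into_space[OF assms(3)] by (simp add: space_pair_measure)
  then have *: "(\<lambda>\<omega>. (\<omega>, k)) -` E \<inter> space (Pinf m) = (\<lambda>\<omega>. (\<omega>, k)) -` E" for k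
    by auto
  have "(\<lambda>\<omega>. (\<omega>, k)) \<in> measurable (Pch m (nat k) i \<theta>) (Pinf m \<Otimes>\<^sub>M count_space UNIV)" for k :: int
    unfolding measurable_cong_sets[OF sets_Pch[OF assms(1,2)] refl] by simp
  then show ?thesis
    unfolding Ppi_def
    by (simp add: emeasure_bind[OF _ Ppi_kernel[OF assms(1,2)] assms(3)] emeasure_distr assms(3) * sp)
qed

text \<open>The defining formula of the joint law on rectangles.\<close>

lemma emeasure_Ppi_Times:
  assumes "i \<in> stream_ids m" "\<theta> \<in> Param m i" "B \<in> sets (Pinf m)"
  shows "emeasure (Ppi m i \<theta>) (B \<times> K) =
    (\<integral>\<^sup>+ k. ennreal (pmf (prior m) k) * emeasure (Pch m (nat k) i \<theta>) B \<partial>count_space K)"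
proof -
  have "(\<lambda>\<omega>. (\<omega>, k)) -` (B \<times> K) = (if k \<in> K then B else {})" for k
    by auto
  then show ?thesis
    using assms by (auto simp: emeasure_Ppi nn_integral_measure_pmf nn_integral_count_space_indicator
        intro!: nn_integral_cong split: split_indicator)
qed

lemma prob_space_Ppi:
  assumes "i \<in> stream_ids m" "\<theta> \<in> Param m i"
  shows "prob_space (Ppi m i \<theta>)"
  unfolding Ppi_def
proof (rule measure_pmf.prob_space_bind[OF _ Ppi_kernel[OF assms]], rule AE_I2)
  fix k :: int
  have "(\<lambda>\<omega>. (\<omega>, k)) \<in> measurable (Pch m (nat k) i \<theta>) (Pinf m \<Otimes>\<^sub>M count_space UNIV)"
    unfolding measurable_cong_sets[OF sets_Pch[OF assms] refl] by simp
  then show "prob_space (distr (Pch m (nat k) i \<theta>) (Pinf m \<Otimes>\<^sub>M count_space UNIV) (\<lambda>\<omega>. (\<omega>, k)))"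
    by (rule prob_space.prob_space_distr[OF prob_space_Pch[OF assms]])
qed

lemma emeasure_Pch_Fn:
  assumes "i \<in> stream_ids m" "\<theta> \<in> Param m i" "n \<le> k" "B \<in> sets (Fn m n)"
  shows "emeasure (Pch m k i \<theta>) B = emeasure (Pinf m) B"
proof -
  have sp: "space (Pch m k i \<theta>) = space (Pinf m)"
    using sets_Pch[OF assms(1,2)] by (rule sets_eq_imp_space_eq)
  have "obs_vec m n \<in> space (Pinf m) \<rightarrow> space (obs_space m n)"
    using measurable_space[OF obs_vec_measurable] by auto
  then obtain C where C: "C \<in> sets (obs_space m n)" "B = obs_vec m n -` C \<inter> space (Pinf m)"
    using assms(4) by (auto simp: Fn_def sets_vimage_algebra2)
  have "distr (Pch m k i \<theta>) (obs_space m n) (obs_vec m n) = distr (Pinf m) (obs_space m n) (obs_vec m n)"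
    using law_Pch[OF assms(1,2), of k n] law_Pinf[of n] assms(3)
    by (simp add: distributed_def dens_ch_def)
  from arg_cong[OF this, of "\<lambda>M. emeasure M C"] show ?thesis
    using law_Pch[OF assms(1,2), of k n] obs_vec_measurable[of n] C
    by (simp add: emeasure_distr distributed_def sp)
qed

text \<open>The false alarm probability is the probability of the event that \<open>T \<le> \<nu>\<close>, whatever the
  post-change stream and parameter are.\<close>

lemma PFA_eq:
  assumes "i \<in> stream_ids m" "\<theta> \<in> Param m i" "di_rule m (d, T)"
  shows "PFA m (d, T) = \<P>(z in Ppi m i \<theta>. ereal_of_enat (T (fst z)) \<le> ereal (of_int (snd z)))"
proof -
  interpret P: prob_space "Pinf m" by (rule prob_space_Pinf)
  define E where "E = {z \<in> space (Ppi m i \<theta>). ereal_of_enat (T (fst z)) \<le> ereal (of_int (snd z))}"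
  define D where "D n = {\<omega> \<in> space (Pinf m). T \<omega> \<le> enat n}" for n
  have D: "D n \<in> sets (Fn m n)" for n
  proof -
    have "Measurable.pred (Filt m (enat n)) (\<lambda>\<omega>. T \<omega> \<le> enat n)"
      using assms(3) by (auto simp: di_rule_def dest: stopping_timeD)
    moreover have "space (Fn m n) = space (Pinf m)" by (simp add: Fn_def)
    ultimately show ?thesis by (simp add: Measurable.pred_def Filt_def D_def)
  qed
  have D': "D n \<in> sets (Pinf m)" for n
    using D[of n] obs_vec_measurable[of n] measurable_space[OF obs_vec_measurable[of n]]
    by (auto simp: Fn_def sets_vimage_algebra2 intro: measurable_sets)
  have setsP: "sets (Ppi m i \<theta>) = sets (Pinf m \<Otimes>\<^sub>M count_space UNIV)"
    unfolding Ppi_def by (rule sets_bind) (auto simp: measure_pmf.not_empty)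
  have sect: "(\<lambda>\<omega>. (\<omega>, k)) -` E = (if k < 0 then {} else D (nat k))" for k
  proof -
    have "real n \<le> of_int k \<longleftrightarrow> 0 \<le> k \<and> n \<le> nat k" for n
      by linarith
    then have "ereal_of_enat (T \<omega>) \<le> ereal (of_int k) \<longleftrightarrow> 0 \<le> k \<and> T \<omega> \<le> enat (nat k)" for \<omega>
      by (cases "T \<omega>") auto
    moreover have "space (Ppi m i \<theta>) = space (Pinf m) \<times> UNIV"
      using sets_eq_imp_space_eq[OF setsP] by (simp add: space_pair_measure)
    ultimately show ?thesis
      by (auto simp: E_def D_def)
  qed
  have "E = (\<Union>n. D n \<times> {int n})"
  proof (intro set_eqI)
    fix z
    have "z \<in> E \<longleftrightarrow> fst z \<in> (\<lambda>\<omega>. (\<omega>, snd z)) -` E" by simp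
    also have "\<dots> \<longleftrightarrow> z \<in> (\<Union>n. D n \<times> {int n})"
      by (cases z) (auto simp: sect intro!: exI[of _ "nat (snd z)"])
    finally show "z \<in> E \<longleftrightarrow> z \<in> (\<Union>n. D n \<times> {int n})" .
  qed
  then have E: "E \<in> sets (Pinf m \<Otimes>\<^sub>M count_space UNIV)"
    using D' by auto
  have "emeasure (Ppi m i \<theta>) E =
      (\<integral>\<^sup>+ k. (if k < 0 then 0 else emeasure (Pinf m) (D (nat k))) \<partial>measure_pmf (prior m))"
    unfolding emeasure_Ppi[OF assms(1,2) E]
    by (intro nn_integral_cong) (auto simp: sect emeasure_Pch_Fn[OF assms(1,2) order_refl D])
  also have "\<dots> = (\<integral>\<^sup>+ k. ennreal (pmf (prior m) k) * emeasure (Pinf m) (D (nat k)) \<partial>count_space {0..})"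
    by (auto simp: nn_integral_measure_pmf nn_integral_count_space_indicator
        intro!: nn_integral_cong split: split_indicator)
  also have "\<dots> = (\<integral>\<^sup>+ n. ennreal (pmf (prior m) (int n)) * emeasure (Pinf m) (D n) \<partial>count_space UNIV)"
    by (subst nn_integral_bij_count_space[symmetric, of int UNIV])
       (auto simp: bij_betw_def image_iff intro: exI[of _ "nat _"] zero_le_imp_eq_int)
  also have "\<dots> = (\<Sum>n. ennreal (pmf (prior m) (int n) * P.prob (D n)))"
    by (simp add: nn_integral_count_space_nat P.emeasure_eq_measure ennreal_mult)
  finally have eq: "emeasure (Ppi m i \<theta>) E = (\<Sum>n. ennreal (pmf (prior m) (int n) * P.prob (D n)))" .
  have "(\<Sum>n. ennreal (pmf (prior m) (int n) * P.prob (D n))) \<noteq> \<top>"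
  proof -
    have "prob_space (Ppi m i \<theta>)"
      using prob_space_Ppi[OF assms(1,2)] .
    then show ?thesis
      using prob_space.emeasure_le_1[of "Ppi m i \<theta>" E] by (auto simp: eq[symmetric] top_unique)
  qed
  note fin = this
  have nn: "0 \<le> pmf (prior m) (int n) * P.prob (D n)" for n
    by simp
  have "measure (Ppi m i \<theta>) E = (\<Sum>n. pmf (prior m) (int n) * P.prob (D n))"
    unfolding measure_def[of "Ppi m i \<theta>"] eq suminf_ennreal[OF nn fin]
    by (intro enn2real_ennreal suminf_nonneg summable_suminf_not_top nn fin)
  then show ?thesis
    by (simp add: PFA_def E_def D_def)
qed

end

end

theory Submission
  imports Defs
begin

text \<open>
  All bounds come from one estimate. Let \<open>V\<close> be the probability that \<open>T > \<nu>\<close>. Whether \<open>T > k\<close> is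
  known at time \<open>k\<close>, and up to time \<open>k\<close> every law with change point \<open>k\<close> agrees with \<open>P\<^sub>\<infinity>\<close>; so
  \<open>V\<close> depends neither on the changing stream nor on the parameter, and equals \<open>1 - PFA\<close>. The
  statistic \<open>Lam\<close> of stream \<open>j\<close> is the mixture over prior and parameters of likelihood ratios
  against \<open>P\<^sub>\<infinity>\<close>. Integrating it under \<open>P\<^sub>\<infinity>\<close> over the events that the rule stops at time
  \<open>n\<close> with decision \<open>j\<close>, and summing over \<open>n\<close>, therefore gives at most the mixture probability
  of deciding for \<open>j\<close> after the change, hence at most \<open>V\<close>
  (\<open>stopped_Lam_le_no_false_alarm_prob\<close>).

  False alarms (\<open>PFAi_threshold_rule_le\<close>): when the rule stops at \<open>n\<close> for \<open>i\<close>, the threshold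
  \<open>A i 0\<close> says that \<open>P(\<nu> \<ge> n) \<le> Lam / A i 0\<close>. The left-hand sides add up to \<open>PFAi\<close>, so
  \<open>A i 0 * PFAi \<le> V = 1 - PFA \<le> 1 - PFAi\<close>.

  Misidentification (\<open>PMIij_threshold_rule_le\<close>): when the rule stops for \<open>j\<close>, the threshold
  \<open>A j i\<close> says that the prior-weighted likelihood ratios of stream \<open>i\<close>, for any parameter, are
  at most \<open>Lam / A j i\<close> with \<open>Lam\<close> belonging to \<open>j\<close>. So the probability of a change in \<open>i\<close>
  followed by decision \<open>j\<close> is at most \<open>V / A j i\<close>. Dividing by \<open>V\<close>, the probability conditioned
  on, leaves \<open>1 / A j i\<close>, which is even smaller than the asserted bound.

  The post-change laws need not be absolutely continuous with respect to \<open>P\<^sub>\<infinity>\<close>. One inequality in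
  the change of measure survives this; the other requires a finite likelihood ratio. The latter is
  used only for misidentification, where the crossing of a positive threshold forces the
  denominator, and with it every ratio of positive weight, to be finite.
\<close>

section \<open>Quotients with values in the extended nonnegative reals\<close>

text \<open>
  Multiplying back the denominators can lose mass, because \<open>q / 0 * 0 = 0\<close>, but it never
  creates any.
\<close>

lemma prod_ratio_times_prod_le:
  fixes p q :: "'a \<Rightarrow> ennreal"
  shows "(\<Prod>t\<in>I. q t / p t) * (\<Prod>t\<in>I. p t) \<le> (\<Prod>t\<in>I. q t)"
proof -
  have "q t / p t * p t \<le> q t" for t
  proof (cases "p t = 0 \<or> p t = \<top>")
    case True
    then show ?thesis by auto
  next
    case False
    then show ?thesis
      using ennreal_mult_divide_eq[of "p t" "q t"] by (simp add: ennreal_times_divide mult.commute)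
  qed
  then show ?thesis
    unfolding prod.distrib[symmetric]
    by (induction I rule: infinite_finite_induct) (auto intro: mult_mono)
qed

text \<open>
  The converse of the previous bound. A loss needs some \<open>p t = 0\<close> with \<open>q t > 0\<close>. If no other
  factor vanishes, this makes the product of the quotients infinite; if some \<open>q t\<close> vanishes, the
  left-hand side is \<open>0\<close> and there is nothing to show.
\<close>

lemma prod_le_prod_ratio_times_prod:
  fixes p q :: "'a \<Rightarrow> ennreal"
  assumes "finite I" and p: "\<And>t. t \<in> I \<Longrightarrow> p t \<noteq> \<top>" and fin: "(\<Prod>t\<in>I. q t / p t) \<noteq> \<top>"
  shows "(\<Prod>t\<in>I. q t) \<le> (\<Prod>t\<in>I. q t / p t) * (\<Prod>t\<in>I. p t)"
proof (cases "\<exists>t\<in>I. q t = 0")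
  case True
  then have "(\<Prod>t\<in>I. q t) = 0" using assms(1) by (intro prod_zero)
  then show ?thesis by (simp only: zero_le)
next
  case False
  have nz: "q t / p t \<noteq> 0" if "t \<in> I" for t
    using False p that by (auto simp: ennreal_divide_eq_0_iff)
  have p0: "p t \<noteq> 0" if "t \<in> I" for t
  proof
    assume "p t = 0"
    then have "q t / p t = \<top>" using False that by (simp add: ennreal_divide_zero)
    with fin nz that assms(1) show False by (auto simp: ennreal_prod_eq_top)
  qed
  have "q t / p t * p t = q t" if "t \<in> I" for t
    using ennreal_mult_divide_eq[of "p t" "q t"] p[OF that] p0[OF that]
    by (simp add: ennreal_times_divide mult.commute)
  then show ?thesis
    unfolding prod.distrib[symmetric] by simp
qed

text \<open>
  A threshold crossing excludes an infinite denominator, because \<open>x / \<infinity> = 0\<close>. This is what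
  makes the likelihood ratios against the competing stream finite when an alarm is raised.
\<close>

lemma ennreal_divide_geD:
  fixes x y :: ennreal
  assumes "ennreal a \<le> x / y" "0 < a"
  shows "y \<noteq> \<top>" "ennreal a * y \<le> x"
proof -
  show top: "y \<noteq> \<top>"
  proof
    assume "y = \<top>"
    with assms show False by simp
  qed
  show "ennreal a * y \<le> x"
  proof (cases "y = 0")
    case False
    have "ennreal a * y \<le> x / y * y" using assms(1) by (rule mult_right_mono) simp
    also have "\<dots> = x" using ennreal_mult_divide_eq[of y x] False top
      by (simp add: ennreal_times_divide mult.commute)
    finally show ?thesis .
  qed simp
qed

section \<open>Likelihood ratios as functions of the sample path\<close>

text \<open>
  Factoring the likelihood ratio through the observed path lets its expectations be computed with
  the densities of the path. The change point \<open>-1\<close> has the same ratio as \<open>0\<close>, so a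
  natural number suffices.
\<close>

definition path_LR ::
  "('w, 'x, 'e) cp_model \<Rightarrow> nat \<Rightarrow> 'e \<Rightarrow> nat \<Rightarrow> nat \<Rightarrow> (nat \<Rightarrow> nat \<Rightarrow> 'x) \<Rightarrow> ennreal" where
  "path_LR m i \<theta> k n y =
     (\<Prod>t\<in>{k+1..n}. ennreal (post_at m i \<theta> t (y i)) / ennreal (pre_at m i t (y i)))"

lemma LR_eq_path_LR:
  assumes "i \<in> stream_ids m" "-1 \<le> k"
  shows "LR m i \<theta> k n \<omega> = path_LR m i \<theta> (nat k) n (obs_vec m n \<omega>)"
proof -
  have lr1: "lr1 m i \<theta> t \<omega> =
      ennreal (post_at m i \<theta> t (obs_vec m n \<omega> i)) / ennreal (pre_at m i t (obs_vec m n \<omega> i))"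
    if "t \<in> {1..n}" for t
  proof -
    have "restrict (obs_vec m n \<omega> i) {1..<t} = restrict (\<lambda>s. Obs m i s \<omega>) {1..<t}"
      using that assms(1) by (auto simp: obs_vec_def fun_eq_iff restrict_def)
    then show ?thesis
      using that assms(1) by (simp add: lr1_def post_at_def pre_at_def obs_vec_def)
  qed
  have "LR m i \<theta> k n \<omega> = (\<Prod>t\<in>{nat k + 1..n}. lr1 m i \<theta> t \<omega>)"
  proof (cases "k = -1")
    case True
    have "(\<Prod>t\<in>{0..n}. lr1 m i \<theta> t \<omega>) = (\<Prod>t\<in>{1..n}. lr1 m i \<theta> t \<omega>)"
      by (intro prod.mono_neutral_right) (auto simp: lr1_def Suc_le_eq)
    then show ?thesis by (simp add: LR_def True)
  next
    case False
    then have "nat (k + 1) = nat k + 1" using assms(2) by simp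
    then show ?thesis by (simp add: LR_def)
  qed
  then show ?thesis by (simp add: path_LR_def lr1)
qed

context changepoint_model
begin

lemma stream_history_measurable:
  assumes "i \<in> stream_ids m" "t \<in> {1..n}"
  shows "(\<lambda>y. restrict (y i) {1..<t}) \<in> measurable (obs_space m n) (hist_space m i {1..<t})"
proof -
  have "(\<lambda>y. y i) \<in> measurable (obs_space m n) (PiM {1..n} (\<lambda>_. Ref m i))"
    using measurable_component_singleton[OF assms(1), of "\<lambda>i. hist_space m i {1..n}"]
    by (simp add: obs_space_def hist_space_def)
  moreover have "{1..<t} \<subseteq> {1..n}" using assms(2) by auto
  note measurable_restrict_subset[OF this]
  ultimately show ?thesis
    unfolding hist_space_def by (rule measurable_compose)
qed

lemma stream_obs_measurable:
  assumes "i \<in> stream_ids m" "t \<in> {1..n}"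
  shows "(\<lambda>y. y i t) \<in> measurable (obs_space m n) (Ref m i)"
proof -
  have "(\<lambda>y. y i) \<in> measurable (obs_space m n) (PiM {1..n} (\<lambda>_. Ref m i))"
    using measurable_component_singleton[OF assms(1), of "\<lambda>i. hist_space m i {1..n}"]
    by (simp add: obs_space_def hist_space_def)
  from measurable_compose[OF this measurable_component_singleton[OF assms(2)]] show ?thesis .
qed

lemma pre_at_measurable:
  assumes "i \<in> stream_ids m" "t \<in> {1..n}"
  shows "(\<lambda>y. pre_at m i t (y i)) \<in> borel_measurable (obs_space m n)"
proof -
  have "(\<lambda>y. (restrict (y i) {1..<t}, y i t)) \<in>
      measurable (obs_space m n) (hist_space m i {1..<t} \<Otimes>\<^sub>M Ref m i)"
    using assms by (intro measurable_Pair stream_history_measurable stream_obs_measurable) auto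
  from measurable_compose[OF this pre_measurable] show ?thesis
    using assms by (simp add: pre_at_def)
qed

lemma post_at_measurable:
  assumes "i \<in> stream_ids m" "t \<in> {1..n}"
  shows "(\<lambda>(\<theta>, y). post_at m i \<theta> t (y i)) \<in>
    borel_measurable (restrict_space borel (Param m i) \<Otimes>\<^sub>M obs_space m n)"
proof -
  let ?P = "restrict_space borel (Param m i) \<Otimes>\<^sub>M obs_space m n"
  have "(\<lambda>z. (fst z, restrict (snd z i) {1..<t}, snd z i t)) \<in>
      measurable ?P (restrict_space borel (Param m i) \<Otimes>\<^sub>M (hist_space m i {1..<t} \<Otimes>\<^sub>M Ref m i))"
    using assms measurable_compose[OF measurable_snd stream_history_measurable[of i t n]]
      measurable_compose[OF measurable_snd stream_obs_measurable[of i t n]]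
    by (intro measurable_Pair measurable_fst) auto
  from measurable_compose[OF this post_measurable] show ?thesis
    using assms by (simp add: post_at_def split_beta')
qed

lemma pre_at_nonneg:
  assumes "i \<in> stream_ids m" "t \<in> {1..n}" "y \<in> space (obs_space m n)"
  shows "0 \<le> pre_at m i t (y i)"
  unfolding pre_at_def using assms
    measurable_space[OF stream_history_measurable[of i t n] assms(3)]
    measurable_space[OF stream_obs_measurable[of i t n] assms(3)]
  by (intro pre_nonneg) auto

lemma post_at_nonneg:
  assumes "i \<in> stream_ids m" "\<theta> \<in> Param m i" "t \<in> {1..n}" "y \<in> space (obs_space m n)"
  shows "0 \<le> post_at m i \<theta> t (y i)"
  unfolding post_at_def using assms
    measurable_space[OF stream_history_measurable[of i t n] assms(4)]
    measurable_space[OF stream_obs_measurable[of i t n] assms(4)]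
  by (intro post_nonneg) auto

lemma path_LR_measurable_pair:
  assumes "i \<in> stream_ids m"
  shows "(\<lambda>(\<theta>, y). path_LR m i \<theta> k n y) \<in>
    borel_measurable (restrict_space borel (Param m i) \<Otimes>\<^sub>M obs_space m n)"
proof -
  let ?P = "restrict_space borel (Param m i) \<Otimes>\<^sub>M obs_space m n"
  have "(\<lambda>z. \<Prod>t\<in>{k+1..n}. ennreal (post_at m i (fst z) t (snd z i)) /
      ennreal (pre_at m i t (snd z i))) \<in> borel_measurable ?P"
  proof (intro borel_measurable_prod_ennreal borel_measurable_divide_ennreal)
    fix t assume t: "t \<in> {k+1..n}"
    show "(\<lambda>z. ennreal (post_at m i (fst z) t (snd z i))) \<in> borel_measurable ?P"
      using post_at_measurable[OF assms, of t n] t by (simp add: split_beta')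
    show "(\<lambda>z. ennreal (pre_at m i t (snd z i))) \<in> borel_measurable ?P"
      using measurable_compose[OF measurable_snd pre_at_measurable[OF assms, of t n]] t
      by (intro measurable_compose[OF _ measurable_ennreal]) auto
  qed
  then show ?thesis by (simp add: path_LR_def split_beta')
qed

lemma path_LR_measurable:
  assumes "i \<in> stream_ids m" "\<theta> \<in> Param m i"
  shows "path_LR m i \<theta> k n \<in> borel_measurable (obs_space m n)"
  using measurable_compose[OF measurable_Pair1' path_LR_measurable_pair[OF assms(1), of k n], of \<theta>] assms(2)
  by (simp add: space_restrict_space)

text \<open>
  The two densities share the factors of the unaffected streams and those of stream \<open>i\<close> up to time
  \<open>k\<close>; this common part is \<open>c\<close>. They differ only in the factors that make up \<open>path_LR\<close>.
\<close>

lemma dens_factor: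
  assumes "i \<in> stream_ids m" "\<theta> \<in> Param m i" "k < n" "y \<in> space (obs_space m n)"
  obtains c where
    "ennreal (dens_inf m n y) = c * (\<Prod>t\<in>{k+1..n}. ennreal (pre_at m i t (y i)))"
    "ennreal (dens_ch m k i \<theta> n y) = c * (\<Prod>t\<in>{k+1..n}. ennreal (post_at m i \<theta> t (y i)))"
proof -
  define P where "P = (\<Prod>t\<in>{1..k}. pre_at m i t (y i))"
  define R where "R = (\<Prod>j\<in>stream_ids m - {i}. \<Prod>t\<in>{1..n}. pre_at m j t (y j))"
  have "{1..n} = {1..k} \<union> {k+1..n}" using assms(3) by auto
  then have split: "(\<Prod>t\<in>{1..n}. pre_at m i t (y i)) = P * (\<Prod>t\<in>{k+1..n}. pre_at m i t (y i))"
    unfolding P_def by (subst prod.union_disjoint[symmetric]) auto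
  have fin: "finite (stream_ids m)" by (simp add: stream_ids_def)
  have "dens_inf m n y = (\<Prod>j\<in>stream_ids m. \<Prod>t\<in>{1..n}. pre_at m j t (y j))"
    unfolding dens_inf_def by (rule prod.swap)
  also have "\<dots> = (P * R) * (\<Prod>t\<in>{k+1..n}. pre_at m i t (y i))"
    by (simp only: prod.remove[OF fin assms(1)] split R_def mult_ac)
  finally have inf: "dens_inf m n y = (P * R) * (\<Prod>t\<in>{k+1..n}. pre_at m i t (y i))" .
  have ch: "dens_ch m k i \<theta> n y = (P * R) * (\<Prod>t\<in>{k+1..n}. post_at m i \<theta> t (y i))"
    using assms(3) by (simp add: dens_ch_def P_def R_def)
  have pre: "0 \<le> pre_at m j t (y j)" if "j \<in> stream_ids m" "t \<in> {1..n}" for j t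
    using pre_at_nonneg[OF that assms(4)] .
  have PR: "0 \<le> P * R"
    unfolding P_def R_def using pre assms(1,3) by (intro mult_nonneg_nonneg prod_nonneg ballI) auto
  have "ennreal (dens_inf m n y) = ennreal (P * R) * (\<Prod>t\<in>{k+1..n}. ennreal (pre_at m i t (y i)))"
    unfolding inf using PR pre[OF assms(1)]
    by (subst ennreal_mult, simp_all del: atLeastAtMost_iff)
       (auto intro!: prod_nonneg prod_ennreal[symmetric] arg_cong2[where f = "(*)"])
  moreover have
    "ennreal (dens_ch m k i \<theta> n y) = ennreal (P * R) * (\<Prod>t\<in>{k+1..n}. ennreal (post_at m i \<theta> t (y i)))"
    unfolding ch using PR post_at_nonneg[OF assms(1,2) _ assms(4)]
    by (subst ennreal_mult, simp_all del: atLeastAtMost_iff)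
       (auto intro!: prod_nonneg prod_ennreal[symmetric] arg_cong2[where f = "(*)"])
  ultimately show ?thesis using that by blast
qed

section \<open>Change of measure at a fixed time\<close>

lemma Fn_vimage:
  assumes "B \<in> sets (Fn m n)"
  obtains C where "C \<in> sets (obs_space m n)" "B = obs_vec m n -` C \<inter> space (Pinf m)"
proof -
  have "obs_vec m n \<in> space (Pinf m) \<rightarrow> space (obs_space m n)"
    using measurable_space[OF obs_vec_measurable] by auto
  then show ?thesis
    using assms that by (auto simp: Fn_def sets_vimage_algebra2)
qed

lemma Fn_subset_Pinf: "B \<in> sets (Fn m n) \<Longrightarrow> B \<in> sets (Pinf m)"
  using obs_vec_measurable[of n] by (elim Fn_vimage) (auto intro: measurable_sets)

text \<open>
  Change of measure from \<open>P\<^sub>\<infinity>\<close> to a post-change law. It is only an inequality, since the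
  post-change law may charge events on which the pre-change density vanishes.
\<close>

lemma nn_integral_LR_le_Pch:
  assumes "i \<in> stream_ids m" "\<theta> \<in> Param m i" "-1 \<le> k" "nat k < n" "B \<in> sets (Fn m n)"
  shows "(\<integral>\<^sup>+\<omega>. LR m i \<theta> k n \<omega> * indicator B \<omega> \<partial>Pinf m) \<le> emeasure (Pch m (nat k) i \<theta>) B"
proof -
  obtain C where C: "C \<in> sets (obs_space m n)" "B = obs_vec m n -` C \<inter> space (Pinf m)"
    using assms(5) by (rule Fn_vimage)
  have sp: "space (Pch m k i \<theta>) = space (Pinf m)" for k
    using sets_Pch[OF assms(1,2)] by (rule sets_eq_imp_space_eq)
  note kn = assms(4)
  let ?g = "\<lambda>y. path_LR m i \<theta> (nat k) n y * indicator C y"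
  have "(\<integral>\<^sup>+\<omega>. LR m i \<theta> k n \<omega> * indicator B \<omega> \<partial>Pinf m) = (\<integral>\<^sup>+\<omega>. ?g (obs_vec m n \<omega>) \<partial>Pinf m)"
    using C(2) by (intro nn_integral_cong) (simp add: LR_eq_path_LR[OF assms(1,3)] indicator_def)
  also have "\<dots> = (\<integral>\<^sup>+y. ennreal (dens_inf m n y) * ?g y \<partial>obs_space m n)"
    using path_LR_measurable[OF assms(1,2)] C(1)
    by (intro distributed_nn_integral[OF law_Pinf, symmetric]) auto
  also have "\<dots> \<le> (\<integral>\<^sup>+y. ennreal (dens_ch m (nat k) i \<theta> n y) * indicator C y \<partial>obs_space m n)"
  proof (rule nn_integral_mono)
    fix y assume y: "y \<in> space (obs_space m n)"
    obtain c where c: "ennreal (dens_inf m n y) = c * (\<Prod>t\<in>{nat k+1..n}. ennreal (pre_at m i t (y i)))"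
      "ennreal (dens_ch m (nat k) i \<theta> n y) = c * (\<Prod>t\<in>{nat k+1..n}. ennreal (post_at m i \<theta> t (y i)))"
      by (rule dens_factor[OF assms(1,2) kn y])
    have "path_LR m i \<theta> (nat k) n y * (\<Prod>t\<in>{nat k+1..n}. ennreal (pre_at m i t (y i)))
        \<le> (\<Prod>t\<in>{nat k+1..n}. ennreal (post_at m i \<theta> t (y i)))"
      unfolding path_LR_def by (rule prod_ratio_times_prod_le)
    from mult_left_mono[OF this, of c]
    have "ennreal (dens_inf m n y) * path_LR m i \<theta> (nat k) n y \<le> ennreal (dens_ch m (nat k) i \<theta> n y)"
      unfolding c by (simp add: mult_ac)
    then show "ennreal (dens_inf m n y) * ?g y \<le> ennreal (dens_ch m (nat k) i \<theta> n y) * indicator C y"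
      by (simp add: indicator_def)
  qed
  also have "\<dots> = emeasure (Pch m (nat k) i \<theta>) B"
    using distributed_emeasure[OF law_Pch[OF assms(1,2)] C(1), of "nat k"] C(2) by (simp add: sp)
  finally show ?thesis .
qed

text \<open>
  On an event where the likelihood ratio is finite the post-change law has no singular part, so the
  change of measure loses nothing.
\<close>

lemma Pch_le_nn_integral_LR:
  assumes "i \<in> stream_ids m" "\<theta> \<in> Param m i" "-1 \<le> k" "nat k < n" "B \<in> sets (Fn m n)"
    and fin: "\<And>\<omega>. \<omega> \<in> B \<Longrightarrow> LR m i \<theta> k n \<omega> \<noteq> \<top>"
  shows "emeasure (Pch m (nat k) i \<theta>) B \<le> (\<integral>\<^sup>+\<omega>. LR m i \<theta> k n \<omega> * indicator B \<omega> \<partial>Pinf m)"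
proof -
  obtain C0 where C0: "C0 \<in> sets (obs_space m n)" "B = obs_vec m n -` C0 \<inter> space (Pinf m)"
    using assms(5) by (rule Fn_vimage)
  note meas = path_LR_measurable[OF assms(1,2), of "nat k" n, measurable]
  \<comment> \<open>Paths with an infinite ratio do not occur on \<open>B\<close>, so removing them from \<open>C0\<close> keeps the preimage.\<close>
  define C where "C = {y \<in> C0. path_LR m i \<theta> (nat k) n y \<noteq> \<top>}"
  have C_eq: "C = C0 \<inter> {y \<in> space (obs_space m n). path_LR m i \<theta> (nat k) n y \<noteq> \<top>}"
    using sets.sets_into_space[OF C0(1)] by (auto simp: C_def)
  have C: "C \<in> sets (obs_space m n)"
    unfolding C_eq using C0(1) by measurable
  have B: "B = obs_vec m n -` C \<inter> space (Pinf m)"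
    using C0(2) fin by (auto simp: C_def LR_eq_path_LR[OF assms(1,3)])
  have sp: "space (Pch m k i \<theta>) = space (Pinf m)" for k
    using sets_Pch[OF assms(1,2)] by (rule sets_eq_imp_space_eq)
  note kn = assms(4)
  let ?g = "\<lambda>y. path_LR m i \<theta> (nat k) n y * indicator C y"
  have "emeasure (Pch m (nat k) i \<theta>) B =
      (\<integral>\<^sup>+y. ennreal (dens_ch m (nat k) i \<theta> n y) * indicator C y \<partial>obs_space m n)"
    using distributed_emeasure[OF law_Pch[OF assms(1,2)] C, of "nat k"] B by (simp add: sp)
  also have "\<dots> \<le> (\<integral>\<^sup>+y. ennreal (dens_inf m n y) * ?g y \<partial>obs_space m n)"
  proof (rule nn_integral_mono)
    fix y assume y: "y \<in> space (obs_space m n)"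
    obtain c where c: "ennreal (dens_inf m n y) = c * (\<Prod>t\<in>{nat k+1..n}. ennreal (pre_at m i t (y i)))"
      "ennreal (dens_ch m (nat k) i \<theta> n y) = c * (\<Prod>t\<in>{nat k+1..n}. ennreal (post_at m i \<theta> t (y i)))"
      by (rule dens_factor[OF assms(1,2) kn y])
    show "ennreal (dens_ch m (nat k) i \<theta> n y) * indicator C y \<le> ennreal (dens_inf m n y) * ?g y"
    proof (cases "y \<in> C")
      case True
      then have "(\<Prod>t\<in>{nat k+1..n}. ennreal (post_at m i \<theta> t (y i)))
        \<le> path_LR m i \<theta> (nat k) n y * (\<Prod>t\<in>{nat k+1..n}. ennreal (pre_at m i t (y i)))"
        unfolding C_def path_LR_def by (intro prod_le_prod_ratio_times_prod) auto
      from mult_left_mono[OF this, of c] show ?thesis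
        unfolding c using True by (simp add: mult_ac)
    qed simp
  qed
  also have "\<dots> = (\<integral>\<^sup>+\<omega>. ?g (obs_vec m n \<omega>) \<partial>Pinf m)"
    using C by (intro distributed_nn_integral[OF law_Pinf]) auto
  also have "\<dots> = (\<integral>\<^sup>+\<omega>. LR m i \<theta> k n \<omega> * indicator B \<omega> \<partial>Pinf m)"
    using B by (intro nn_integral_cong) (simp add: LR_eq_path_LR[OF assms(1,3)] indicator_def)
  finally show ?thesis .
qed

section \<open>Stopping and decision events\<close>

text \<open>
  These events, one for each \<open>n\<close>, cut a stopped decision into pieces on which the change of
  measure at the fixed time \<open>n\<close> is available.
\<close>

definition stopped_at :: "('w \<Rightarrow> nat) \<Rightarrow> ('w \<Rightarrow> enat) \<Rightarrow> nat \<Rightarrow> nat \<Rightarrow> 'w set" where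
  "stopped_at d T n j = {\<omega> \<in> space (Pinf m). T \<omega> = enat n \<and> d \<omega> = j}"

definition alarm_after :: "('w \<Rightarrow> enat) \<Rightarrow> int \<Rightarrow> 'w set" where
  "alarm_after T k = {\<omega> \<in> space (Pinf m). ereal (of_int k) < ereal_of_enat (T \<omega>)}"

text \<open>
  The probability that \<open>T > \<nu>\<close>. It is written with \<open>P\<^sub>\<infinity>\<close> alone: up to time \<open>k\<close> every law with
  change point \<open>k\<close> agrees with \<open>P\<^sub>\<infinity>\<close>, so the value is the same for all streams and parameters.
  This is what allows comparing two different streams.
\<close>

definition no_false_alarm_prob :: "('w \<Rightarrow> enat) \<Rightarrow> ennreal" where
  "no_false_alarm_prob T = (\<integral>\<^sup>+k. emeasure (Pinf m) (alarm_after T k) \<partial>measure_pmf (prior m))"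

lemma alarm_after_eq:
  "alarm_after T k = (if k < 0 then space (Pinf m) else {\<omega> \<in> space (Pinf m). enat (nat k) < T \<omega>})"
proof -
  have "of_int k < ereal_of_enat t \<longleftrightarrow> k < 0 \<or> enat (nat k) < t" for t :: enat
  proof (cases t)
    case (enat n)
    have "real_of_int k < real n \<longleftrightarrow> k < 0 \<or> nat k < n" by linarith
    then show ?thesis by (simp add: enat)
  qed simp
  then show ?thesis by (auto simp: alarm_after_def)
qed

lemma space_Fn [simp]: "space (Fn m n) = space (Pinf m)"
  by (simp add: Fn_def)

text \<open>
  The \<sigma>-algebra of the stopping time only controls the decision on \<open>{T \<le> n}\<close>;
  removing \<open>{T < n}\<close> isolates the decisions made at time \<open>n\<close>.
\<close>

lemma stopped_at_sets_Fn:
  assumes "di_rule m (d, T)"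
  shows "stopped_at d T n j \<in> sets (Fn m n)"
proof -
  interpret F: filtration "space (Pinf m)" "Filt m" by (rule filtration_Filt)
  have T: "stopping_time (Filt m) T" and d: "d \<in> measurable (F.pre_sigma T) (count_space (stream_ids m))"
    using assms by (auto simp: di_rule_def)
  have "d -` ({j} \<inter> stream_ids m) \<inter> space (F.pre_sigma T) \<in> sets (F.pre_sigma T)"
    using d by (rule measurable_sets) simp
  moreover have "d -` ({j} \<inter> stream_ids m) \<inter> space (F.pre_sigma T) = {\<omega> \<in> space (Pinf m). d \<omega> = j}"
    using measurable_space[OF d] by (auto simp: F.space_pre_sigma)
  ultimately have "{\<omega> \<in> {\<omega> \<in> space (Pinf m). d \<omega> = j}. T \<omega> \<le> enat n} \<in> sets (Filt m (enat n))"
    by (intro F.sets_pre_sigmaD[OF T]) simp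
  moreover have "{\<omega> \<in> space (Pinf m). T \<omega> < enat n} \<in> sets (Filt m (enat n))"
    using F.stopping_time_less_const[OF T, of "enat n"] by (simp add: pred_def F.space_F)
  ultimately have "{\<omega> \<in> {\<omega> \<in> space (Pinf m). d \<omega> = j}. T \<omega> \<le> enat n} - {\<omega> \<in> space (Pinf m). T \<omega> < enat n}
      \<in> sets (Fn m n)"
    by (simp add: Filt_def sets.Diff)
  also have "{\<omega> \<in> {\<omega> \<in> space (Pinf m). d \<omega> = j}. T \<omega> \<le> enat n} - {\<omega> \<in> space (Pinf m). T \<omega> < enat n} =
      stopped_at d T n j"
    by (auto simp: stopped_at_def)
  finally show ?thesis .
qed

lemma stopped_at_sets_Pinf: "di_rule m (d, T) \<Longrightarrow> stopped_at d T n j \<in> sets (Pinf m)"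
  by (rule Fn_subset_Pinf[OF stopped_at_sets_Fn])

lemma alarm_after_sets_Fn:
  assumes "di_rule m (d, T)"
  shows "alarm_after T k \<in> sets (Fn m (nat k))"
proof -
  have "Measurable.pred (Filt m (enat (nat k))) (\<lambda>\<omega>. enat (nat k) < T \<omega>)"
    using assms by (auto simp: di_rule_def intro: stopping_timeD2)
  then have "{\<omega> \<in> space (Pinf m). enat (nat k) < T \<omega>} \<in> sets (Fn m (nat k))"
    by (simp add: pred_def Filt_def)
  then show ?thesis
    using sets.top[of "Fn m (nat k)"] unfolding alarm_after_eq by (cases "k < 0") simp_all
qed

lemma decision_in_streams:
  assumes "di_rule m (d, T)" "\<omega> \<in> space (Pinf m)"
  shows "d \<omega> \<in> stream_ids m"
proof -
  interpret F: filtration "space (Pinf m)" "Filt m" by (rule filtration_Filt)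
  have "d \<in> measurable (F.pre_sigma T) (count_space (stream_ids m))"
    using assms by (auto simp: di_rule_def)
  from measurable_space[OF this, of \<omega>] show ?thesis
    using assms(2) by (simp add: F.space_pre_sigma)
qed

section \<open>Averaging over change points and parameters\<close>

text \<open>
  Rewriting the finite sum in \<open>Lam\<close> as an integral against the prior moves its range of
  summation, which depends on \<open>n\<close>, into the integrand, so that sums over \<open>n\<close> and over change
  points can be exchanged.
\<close>

lemma prior_sum_eq_nn_integral:
  "(\<Sum>k\<in>{-1..int n - 1}. ennreal (pmf (prior m) k) * f k) =
   (\<integral>\<^sup>+k. (if k < int n then f k else 0) \<partial>measure_pmf (prior m))"
proof -
  have z: "pmf (prior m) k = 0" if "k < -1" for k
    using prior_support that by (auto simp: set_pmf_eq)
  have "(\<integral>\<^sup>+k. (if k < int n then f k else 0) \<partial>measure_pmf (prior m)) =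
      (\<integral>\<^sup>+k. ennreal (pmf (prior m) k) * f k \<partial>count_space {-1..int n - 1})"
    by (auto simp: nn_integral_measure_pmf nn_integral_count_space_indicator z not_le
        intro!: nn_integral_cong split: split_indicator)
  then show ?thesis by (simp add: nn_integral_count_space_finite)
qed

text \<open>
  The error probabilities are defined as real series over change points \<open>k \<ge> 0\<close>. Here they become
  integrals against the prior, to which monotone convergence applies without any summability
  conditions.
\<close>

lemma prior_nat_sum:
  assumes "\<And>k. 0 \<le> f k" "\<And>k. f k \<le> (1::real)"
  shows "summable (\<lambda>k. pmf (prior m) (int k) * f k)" (is ?S)
    and "ennreal (\<Sum>k. pmf (prior m) (int k) * f k) =
      (\<integral>\<^sup>+k. (if k < 0 then 0 else ennreal (f (nat k))) \<partial>measure_pmf (prior m))" (is ?E)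
proof -
  have nn: "0 \<le> pmf (prior m) (int n) * f n" for n
    using assms(1) by simp
  have "(\<integral>\<^sup>+k. (if k < 0 then 0 else ennreal (f (nat k))) \<partial>measure_pmf (prior m)) =
      (\<integral>\<^sup>+k. ennreal (pmf (prior m) k) * ennreal (f (nat k)) \<partial>count_space {0..})"
    by (auto simp: nn_integral_measure_pmf nn_integral_count_space_indicator
        intro!: nn_integral_cong split: split_indicator)
  also have "\<dots> = (\<integral>\<^sup>+n. ennreal (pmf (prior m) (int n)) * ennreal (f n) \<partial>count_space UNIV)"
    by (subst nn_integral_bij_count_space[symmetric, of int UNIV])
       (auto simp: bij_betw_def image_iff intro: exI[of _ "nat _"] zero_le_imp_eq_int)
  also have "\<dots> = (\<Sum>n. ennreal (pmf (prior m) (int n) * f n))"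
    by (simp add: nn_integral_count_space_nat ennreal_mult assms(1))
  finally have eq: "(\<integral>\<^sup>+k. (if k < 0 then 0 else ennreal (f (nat k))) \<partial>measure_pmf (prior m)) =
      (\<Sum>n. ennreal (pmf (prior m) (int n) * f n))" .
  have "(\<integral>\<^sup>+k. (if k < 0 then 0 else ennreal (f (nat k))) \<partial>measure_pmf (prior m))
      \<le> (\<integral>\<^sup>+k. 1 \<partial>measure_pmf (prior m))"
    using assms(2) by (intro nn_integral_mono) auto
  also have "\<dots> = 1" by simp
  finally have fin: "(\<Sum>n. ennreal (pmf (prior m) (int n) * f n)) \<noteq> \<top>"
    unfolding eq by (auto simp: top_unique)
  show ?S using nn fin by (rule summable_suminf_not_top)
  show ?E unfolding eq by (rule suminf_ennreal[OF nn fin, symmetric])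
qed

lemma LR_measurable:
  assumes "i \<in> stream_ids m" "\<theta> \<in> Param m i" "-1 \<le> k"
  shows "LR m i \<theta> k n \<in> borel_measurable (Pinf m)"
  using measurable_compose[OF obs_vec_measurable path_LR_measurable[OF assms(1,2)]]
  by (simp add: LR_eq_path_LR[OF assms(1,3), abs_def])

lemma LR_measurable_pair:
  assumes "i \<in> stream_ids m" "-1 \<le> k"
  shows "(\<lambda>(\<theta>, \<omega>). LR m i \<theta> k n \<omega>) \<in> borel_measurable (Mix m i \<Otimes>\<^sub>M Pinf m)"
proof -
  have "(\<lambda>z. (fst z, obs_vec m n (snd z))) \<in>
      measurable (Mix m i \<Otimes>\<^sub>M Pinf m) (restrict_space borel (Param m i) \<Otimes>\<^sub>M obs_space m n)"
    using measurable_compose[OF measurable_snd obs_vec_measurable]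
    by (intro measurable_Pair)
       (auto simp: measurable_cong_sets[OF refl sets_Mix[OF assms(1), symmetric]])
  from measurable_compose[OF this path_LR_measurable_pair[OF assms(1)]] show ?thesis
    by (simp add: LR_eq_path_LR[OF assms] split_beta')
qed

lemma space_Mix: "i \<in> stream_ids m \<Longrightarrow> space (Mix m i) = Param m i"
  using sets_eq_imp_space_eq[OF sets_Mix] by (simp add: space_restrict_space)

lemma Param_nonempty: "i \<in> stream_ids m \<Longrightarrow> Param m i \<noteq> {}"
  using prob_space.not_empty[OF prob_space_Mix] by (simp add: space_Mix)

lemma mixture_Fubini:
  assumes "i \<in> stream_ids m" "-1 \<le> k" "B \<in> sets (Pinf m)"
  shows "(\<lambda>\<theta>. \<integral>\<^sup>+\<omega>. LR m i \<theta> k n \<omega> * indicator B \<omega> \<partial>Pinf m) \<in> borel_measurable (Mix m i)"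
    and "(\<lambda>\<omega>. \<integral>\<^sup>+\<theta>. LR m i \<theta> k n \<omega> \<partial>Mix m i) \<in> borel_measurable (Pinf m)"
    and "(\<integral>\<^sup>+\<omega>. (\<integral>\<^sup>+\<theta>. LR m i \<theta> k n \<omega> \<partial>Mix m i) * indicator B \<omega> \<partial>Pinf m) =
      (\<integral>\<^sup>+\<theta>. (\<integral>\<^sup>+\<omega>. LR m i \<theta> k n \<omega> * indicator B \<omega> \<partial>Pinf m) \<partial>Mix m i)"
proof -
  interpret P: prob_space "Pinf m" by (rule prob_space_Pinf)
  interpret Q: prob_space "Mix m i" using assms(1) by (rule prob_space_Mix)
  interpret QP: pair_sigma_finite "Mix m i" "Pinf m" ..
  note LR_measurable_pair[OF assms(1,2), of n, measurable] assms(3)[measurable]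
  have meas: "(\<lambda>(\<theta>, \<omega>). LR m i \<theta> k n \<omega> * indicator B \<omega>) \<in> borel_measurable (Mix m i \<Otimes>\<^sub>M Pinf m)"
    by measurable
  show "(\<lambda>\<theta>. \<integral>\<^sup>+\<omega>. LR m i \<theta> k n \<omega> * indicator B \<omega> \<partial>Pinf m) \<in> borel_measurable (Mix m i)"
    using P.borel_measurable_nn_integral[OF meas] .
  show "(\<lambda>\<omega>. \<integral>\<^sup>+\<theta>. LR m i \<theta> k n \<omega> \<partial>Mix m i) \<in> borel_measurable (Pinf m)"
    using measurable_pair_swap[OF LR_measurable_pair[OF assms(1,2), of n]]
    by (intro Q.borel_measurable_nn_integral) (simp add: split_beta')
  have sec: "(\<lambda>\<theta>. LR m i \<theta> k n \<omega>) \<in> borel_measurable (Mix m i)" if "\<omega> \<in> space (Pinf m)" for \<omega>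
    using measurable_compose[OF measurable_Pair2' LR_measurable_pair[OF assms(1,2), of n], of \<omega>] that by simp
  have "(\<integral>\<^sup>+\<omega>. (\<integral>\<^sup>+\<theta>. LR m i \<theta> k n \<omega> \<partial>Mix m i) * indicator B \<omega> \<partial>Pinf m) =
      (\<integral>\<^sup>+\<omega>. (\<integral>\<^sup>+\<theta>. LR m i \<theta> k n \<omega> * indicator B \<omega> \<partial>Mix m i) \<partial>Pinf m)"
    by (intro nn_integral_cong nn_integral_multc[symmetric] sec)
  also have "\<dots> = (\<integral>\<^sup>+\<theta>. (\<integral>\<^sup>+\<omega>. LR m i \<theta> k n \<omega> * indicator B \<omega> \<partial>Pinf m) \<partial>Mix m i)"
    using meas by (rule QP.Fubini')
  finally show "(\<integral>\<^sup>+\<omega>. (\<integral>\<^sup>+\<theta>. LR m i \<theta> k n \<omega> \<partial>Mix m i) * indicator B \<omega> \<partial>Pinf m) =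
      (\<integral>\<^sup>+\<theta>. (\<integral>\<^sup>+\<omega>. LR m i \<theta> k n \<omega> * indicator B \<omega> \<partial>Pinf m) \<partial>Mix m i)" .
qed

text \<open>
  The times are written \<open>Suc n\<close> because the threshold rule never stops at time \<open>0\<close>.
\<close>

lemma suminf_stopped_at:
  assumes "di_rule m (d, T)" "sets M = sets (Pinf m)"
  shows "(\<Sum>n. if P n then emeasure M (stopped_at d T (Suc n) j) else 0) =
    emeasure M (\<Union>n\<in>{n. P n}. stopped_at d T (Suc n) j)"
proof -
  let ?F = "\<lambda>n. if P n then stopped_at d T (Suc n) j else {}"
  have "(\<Sum>n. if P n then emeasure M (stopped_at d T (Suc n) j) else 0) = (\<Sum>n. emeasure M (?F n))"
    by (intro suminf_cong) simp
  also have "\<dots> = emeasure M (\<Union>n. ?F n)"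
    using stopped_at_sets_Pinf[OF assms(1)] assms(2)
    by (intro suminf_emeasure) (auto simp: disjoint_family_on_def stopped_at_def)
  also have "(\<Union>n. ?F n) = (\<Union>n\<in>{n. P n}. stopped_at d T (Suc n) j)"
    by (auto split: if_splits)
  finally show ?thesis .
qed

text \<open>
  By Fubini and the change of measure, the contribution of change point \<open>k\<close> and parameter
  \<open>\<theta>\<close> to the integral at time \<open>n > k\<close> is at most the probability, under the law with
  change at \<open>k\<close> in stream \<open>j\<close>, of deciding for \<open>j\<close> at time \<open>n\<close>. These events are disjoint
  and lie in \<open>{T > k}\<close>, whose probability is the same as under \<open>P\<^sub>\<infinity>\<close> and hence free of
  \<open>\<theta>\<close>; averaging over \<open>\<theta>\<close> and \<open>k\<close> gives the bound.
\<close>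

lemma stopped_Lam_le_no_false_alarm_prob:
  assumes "di_rule m (d, T)" "j \<in> stream_ids m"
  shows "(\<Sum>n. \<integral>\<^sup>+\<omega>. Lam m j (Suc n) \<omega> * indicator (stopped_at d T (Suc n) j) \<omega> \<partial>Pinf m)
    \<le> no_false_alarm_prob T"
proof -
  define E where "E n = stopped_at d T (Suc n) j" for n
  have E: "E n \<in> sets (Fn m (Suc n))" "E n \<in> sets (Pinf m)" for n
    using stopped_at_sets_Fn[OF assms(1)] stopped_at_sets_Pinf[OF assms(1)] by (auto simp: E_def)
  define G where "G k n \<theta> = (\<integral>\<^sup>+\<omega>. LR m j \<theta> k (Suc n) \<omega> * indicator (E n) \<omega> \<partial>Pinf m)" for k n \<theta>
  interpret Q: prob_space "Mix m j" using assms(2) by (rule prob_space_Mix)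
  have G_meas: "G k n \<in> borel_measurable (Mix m j)" if "-1 \<le> k" for k n
    using mixture_Fubini(1)[OF assms(2) that E(2)] by (simp add: G_def[abs_def])
  have Lam: "(\<integral>\<^sup>+\<omega>. Lam m j (Suc n) \<omega> * indicator (E n) \<omega> \<partial>Pinf m) =
      (\<integral>\<^sup>+k. (if k < int (Suc n) then \<integral>\<^sup>+\<theta>. G k n \<theta> \<partial>Mix m j else 0) \<partial>measure_pmf (prior m))" for n
  proof -
    note E(2)[measurable]
    have "(\<integral>\<^sup>+\<omega>. Lam m j (Suc n) \<omega> * indicator (E n) \<omega> \<partial>Pinf m) =
        (\<integral>\<^sup>+\<omega>. (\<Sum>k\<in>{-1..int (Suc n) - 1}. ennreal (pmf (prior m) k) *
          ((\<integral>\<^sup>+\<theta>. LR m j \<theta> k (Suc n) \<omega> \<partial>Mix m j) * indicator (E n) \<omega>)) \<partial>Pinf m)"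
      by (simp add: Lam_def sum_distrib_right mult.assoc)
    also have "\<dots> = (\<Sum>k\<in>{-1..int (Suc n) - 1}. ennreal (pmf (prior m) k) *
        (\<integral>\<^sup>+\<omega>. (\<integral>\<^sup>+\<theta>. LR m j \<theta> k (Suc n) \<omega> \<partial>Mix m j) * indicator (E n) \<omega> \<partial>Pinf m))"
    proof (subst nn_integral_sum)
      fix k assume "k \<in> {-1..int (Suc n) - 1}"
      then have [measurable]: "(\<lambda>\<omega>. \<integral>\<^sup>+\<theta>. LR m j \<theta> k (Suc n) \<omega> \<partial>Mix m j) \<in> borel_measurable (Pinf m)"
        by (intro mixture_Fubini(2)[OF assms(2) _ E(2)]) simp
      show "(\<lambda>\<omega>. ennreal (pmf (prior m) k) *
          ((\<integral>\<^sup>+\<theta>. LR m j \<theta> k (Suc n) \<omega> \<partial>Mix m j) * indicator (E n) \<omega>)) \<in> borel_measurable (Pinf m)"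
        by measurable
    next
      show "(\<Sum>k\<in>{-1..int (Suc n) - 1}. \<integral>\<^sup>+\<omega>. ennreal (pmf (prior m) k) *
          ((\<integral>\<^sup>+\<theta>. LR m j \<theta> k (Suc n) \<omega> \<partial>Mix m j) * indicator (E n) \<omega>) \<partial>Pinf m) =
        (\<Sum>k\<in>{-1..int (Suc n) - 1}. ennreal (pmf (prior m) k) *
        (\<integral>\<^sup>+\<omega>. (\<integral>\<^sup>+\<theta>. LR m j \<theta> k (Suc n) \<omega> \<partial>Mix m j) * indicator (E n) \<omega> \<partial>Pinf m))"
        using mixture_Fubini(2)[OF assms(2) _ E(2)]
        by (intro sum.cong refl nn_integral_cmult borel_measurable_times_ennreal) (auto simp: E(2))
    qed
    also have "\<dots> = (\<Sum>k\<in>{-1..int (Suc n) - 1}. ennreal (pmf (prior m) k) * (\<integral>\<^sup>+\<theta>. G k n \<theta> \<partial>Mix m j))"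
      using mixture_Fubini(3)[OF assms(2) _ E(2)] by (intro sum.cong refl) (simp add: G_def)
    also have "\<dots> = (\<integral>\<^sup>+k. (if k < int (Suc n) then \<integral>\<^sup>+\<theta>. G k n \<theta> \<partial>Mix m j else 0) \<partial>measure_pmf (prior m))"
      by (rule prior_sum_eq_nn_integral)
    finally show ?thesis .
  qed
  have "(\<Sum>n. \<integral>\<^sup>+\<omega>. Lam m j (Suc n) \<omega> * indicator (E n) \<omega> \<partial>Pinf m) =
      (\<integral>\<^sup>+k. (\<Sum>n. if k < int (Suc n) then \<integral>\<^sup>+\<theta>. G k n \<theta> \<partial>Mix m j else 0) \<partial>measure_pmf (prior m))"
    unfolding Lam by (rule nn_integral_suminf[symmetric]) simp
  also have "\<dots> \<le> no_false_alarm_prob T"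
    unfolding no_false_alarm_prob_def
  proof (intro nn_integral_mono_AE AE_pmfI)
    fix k assume "k \<in> set_pmf (prior m)"
    then have k: "-1 \<le> k" using prior_support by auto
    have "(\<Sum>n. if k < int (Suc n) then \<integral>\<^sup>+\<theta>. G k n \<theta> \<partial>Mix m j else 0) =
        (\<Sum>n. \<integral>\<^sup>+\<theta>. (if k < int (Suc n) then G k n \<theta> else 0) \<partial>Mix m j)"
      by (intro suminf_cong) auto
    also have "\<dots> = (\<integral>\<^sup>+\<theta>. (\<Sum>n. if k < int (Suc n) then G k n \<theta> else 0) \<partial>Mix m j)"
      using G_meas[OF k] by (intro nn_integral_suminf[symmetric]) auto
    also have "\<dots> \<le> (\<integral>\<^sup>+\<theta>. emeasure (Pinf m) (alarm_after T k) \<partial>Mix m j)"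
    proof (rule nn_integral_mono)
      fix \<theta> assume "\<theta> \<in> space (Mix m j)"
      then have \<theta>: "\<theta> \<in> Param m j" using assms(2) by (simp add: space_Mix)
      note sets = sets_Pch[OF assms(2) \<theta>]
      have "(\<Sum>n. if k < int (Suc n) then G k n \<theta> else 0) \<le>
          (\<Sum>n. if k < int (Suc n) then emeasure (Pch m (nat k) j \<theta>) (E n) else 0)"
        unfolding G_def using k
        by (intro suminf_le) (auto intro!: nn_integral_LR_le_Pch[OF assms(2) \<theta> k _ E(1)])
      also have "\<dots> = emeasure (Pch m (nat k) j \<theta>) (\<Union>n\<in>{n. k < int (Suc n)}. E n)"
        unfolding E_def by (rule suminf_stopped_at[OF assms(1) sets])
      also have "\<dots> \<le> emeasure (Pch m (nat k) j \<theta>) (alarm_after T k)"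
        using Fn_subset_Pinf[OF alarm_after_sets_Fn[OF assms(1)]]
        by (intro emeasure_mono) (auto simp: sets E_def stopped_at_def alarm_after_eq)
      also have "\<dots> = emeasure (Pinf m) (alarm_after T k)"
        by (rule emeasure_Pch_Fn[OF assms(2) \<theta> order_refl alarm_after_sets_Fn[OF assms(1)]])
      finally show "(\<Sum>n. if k < int (Suc n) then G k n \<theta> else 0) \<le> emeasure (Pinf m) (alarm_after T k)" .
    qed
    also have "\<dots> = emeasure (Pinf m) (alarm_after T k)"
      by (simp add: Q.emeasure_space_1)
    finally show "(\<Sum>n. if k < int (Suc n) then \<integral>\<^sup>+\<theta>. G k n \<theta> \<partial>Mix m j else 0)
        \<le> emeasure (Pinf m) (alarm_after T k)" .
  qed
  finally show ?thesis unfolding E_def .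
qed

section \<open>False alarms\<close>

lemma PFA_summable:
  "summable (\<lambda>k. pmf (prior m) (int k) * \<P>(\<omega> in Pinf m. P \<omega> k))"
  using prior_nat_sum(1)[of "\<lambda>k. \<P>(\<omega> in Pinf m. P \<omega> k)"] prob_space.prob_le_1[OF prob_space_Pinf]
  by simp

lemma PFA_nonneg: "0 \<le> PFA m (d, T)" "0 \<le> PFAi m (d, T) i"
  using PFA_summable by (auto simp: PFA_def PFAi_def intro!: suminf_nonneg)

lemma no_false_alarm_prob_eq:
  assumes "di_rule m (d, T)"
  shows "PFA m (d, T) \<le> 1" "no_false_alarm_prob T = ennreal (1 - PFA m (d, T))"
proof -
  interpret P: prob_space "Pinf m" by (rule prob_space_Pinf)
  have "no_false_alarm_prob T + ennreal (PFA m (d, T)) =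
      (\<integral>\<^sup>+k. emeasure (Pinf m) (alarm_after T k) \<partial>measure_pmf (prior m)) +
      (\<integral>\<^sup>+k. (if k < 0 then 0 else ennreal \<P>(\<omega> in Pinf m. T \<omega> \<le> enat (nat k))) \<partial>measure_pmf (prior m))"
    using prior_nat_sum(2)[of "\<lambda>k. \<P>(\<omega> in Pinf m. T \<omega> \<le> enat k)"]
    by (simp add: no_false_alarm_prob_def PFA_def)
  also have "\<dots> = (\<integral>\<^sup>+k. emeasure (Pinf m) (alarm_after T k) +
      (if k < 0 then 0 else ennreal \<P>(\<omega> in Pinf m. T \<omega> \<le> enat (nat k))) \<partial>measure_pmf (prior m))"
    by (rule nn_integral_add[symmetric]) auto
  also have "\<dots> = (\<integral>\<^sup>+k. 1 \<partial>measure_pmf (prior m))"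
  proof (intro nn_integral_cong)
    fix k
    show "emeasure (Pinf m) (alarm_after T k) +
      (if k < 0 then 0 else ennreal \<P>(\<omega> in Pinf m. T \<omega> \<le> enat (nat k))) = 1"
    proof (cases "k < 0")
      case False
      have A: "alarm_after T k \<in> sets (Pinf m)"
        using assms by (intro Fn_subset_Pinf[OF alarm_after_sets_Fn])
      have "{\<omega> \<in> space (Pinf m). T \<omega> \<le> enat (nat k)} = space (Pinf m) - alarm_after T k"
        using False by (auto simp: alarm_after_eq)
      then have "\<P>(\<omega> in Pinf m. T \<omega> \<le> enat (nat k)) = 1 - P.prob (alarm_after T k)"
        using P.prob_compl[OF A] by simp
      then show ?thesis
        using False by (simp add: P.emeasure_eq_measure ennreal_plus[symmetric] del: ennreal_plus)
    qed (simp add: alarm_after_eq P.emeasure_space_1)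
  qed
  also have "\<dots> = 1" by simp
  finally have sum: "no_false_alarm_prob T + ennreal (PFA m (d, T)) = 1" .
  then have "ennreal (PFA m (d, T)) \<le> 1"
    by (metis add.commute le_iff_add)
  then show le: "PFA m (d, T) \<le> 1" by (simp add: ennreal_le_1)
  have "no_false_alarm_prob T = (no_false_alarm_prob T + ennreal (PFA m (d, T))) - ennreal (PFA m (d, T))"
    by simp
  then show "no_false_alarm_prob T = ennreal (1 - PFA m (d, T))"
    unfolding sum using PFA_nonneg(1) by (simp add: ennreal_minus ennreal_1[symmetric] del: ennreal_1)
qed

lemma PFAi_le_PFA: 
  assumes "di_rule m (d, T)"
  shows "PFAi m (d, T) i \<le> PFA m (d, T)"
proof -
  interpret P: prob_space "Pinf m" by (rule prob_space_Pinf)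
  have "{\<omega> \<in> space (Pinf m). T \<omega> \<le> enat k} \<in> sets (Pinf m)" for k
  proof -
    have "{\<omega> \<in> space (Pinf m). T \<omega> \<le> enat k} = space (Pinf m) - alarm_after T (int k)"
      by (auto simp: alarm_after_eq)
    then show ?thesis
      using Fn_subset_Pinf[OF alarm_after_sets_Fn[OF assms]] by auto
  qed
  then show ?thesis
    unfolding PFAi_def PFA_def prod.case
    by (intro suminf_le mult_left_mono P.finite_measure_mono PFA_summable) auto
qed

lemma PFA_eq_sum_PFAi:
  assumes "di_rule m (d, T)" "\<And>\<omega>. \<omega> \<in> space (Pinf m) \<Longrightarrow> T \<omega> \<noteq> 0"
  shows "PFA m (d, T) = (\<Sum>i\<in>stream_ids m. PFAi m (d, T) i)"
proof -
  interpret P: prob_space "Pinf m" by (rule prob_space_Pinf)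
  have "\<P>(\<omega> in Pinf m. T \<omega> \<le> enat k) = (\<Sum>i\<in>stream_ids m. \<P>(\<omega> in Pinf m. T \<omega> \<le> enat k \<and> d \<omega> = i))" for k
  proof -
    have sets: "{\<omega> \<in> space (Pinf m). T \<omega> \<le> enat k \<and> d \<omega> = i} \<in> sets (Pinf m)" for i
    proof -
      have "{\<omega> \<in> space (Pinf m). T \<omega> \<le> enat k \<and> d \<omega> = i} = (\<Union>n\<in>{..k}. stopped_at d T n i)"
      proof (intro set_eqI)
        fix \<omega>
        show "\<omega> \<in> {\<omega> \<in> space (Pinf m). T \<omega> \<le> enat k \<and> d \<omega> = i} \<longleftrightarrow>
            \<omega> \<in> (\<Union>n\<in>{..k}. stopped_at d T n i)"
          by (cases "T \<omega>") (auto simp: stopped_at_def)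
      qed
      then show ?thesis using stopped_at_sets_Pinf[OF assms(1)] by simp
    qed
    have "{\<omega> \<in> space (Pinf m). T \<omega> \<le> enat k} =
        (\<Union>i\<in>stream_ids m. {\<omega> \<in> space (Pinf m). T \<omega> \<le> enat k \<and> d \<omega> = i})"
      using decision_in_streams[OF assms(1)] by auto
    then show ?thesis
      using sets by (simp, intro P.finite_measure_finite_Union)
        (auto simp: disjoint_family_on_def stream_ids_def)
  qed
  then show ?thesis
    unfolding PFA_def PFAi_def prod.case
    by (simp add: sum_distrib_left suminf_sum[OF PFA_summable])
qed

text \<open>
  Summation by parts: a stop at time \<open>n\<close> under \<open>P\<^sub>\<infinity>\<close> is a false alarm for every change point
  \<open>k \<ge> n\<close>, so it is weighted by \<open>P(\<nu> \<ge> n)\<close>, the denominator of the statistic compared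
  with \<open>A i 0\<close>.
\<close>

lemma PFAi_eq_suminf:
  assumes "di_rule m (d, T)" "\<And>\<omega>. \<omega> \<in> space (Pinf m) \<Longrightarrow> T \<omega> \<noteq> 0"
  shows "ennreal (PFAi m (d, T) i) =
    (\<Sum>n. ennreal (measure_pmf.prob (prior m) {int (Suc n)..}) * emeasure (Pinf m) (stopped_at d T (Suc n) i))"
proof -
  interpret P: prob_space "Pinf m" by (rule prob_space_Pinf)
  have "ennreal (PFAi m (d, T) i) =
      (\<integral>\<^sup>+k. (if k < 0 then 0 else ennreal \<P>(\<omega> in Pinf m. T \<omega> \<le> enat (nat k) \<and> d \<omega> = i)) \<partial>measure_pmf (prior m))"
    unfolding PFAi_def prod.case by (rule prior_nat_sum(2)) auto
  also have "\<dots> = (\<integral>\<^sup>+k. (\<Sum>n. if int (Suc n) \<le> k then emeasure (Pinf m) (stopped_at d T (Suc n) i) else 0)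
      \<partial>measure_pmf (prior m))"
  proof (intro nn_integral_cong)
    fix k
    have "(\<Union>n\<in>{n. int (Suc n) \<le> k}. stopped_at d T (Suc n) i) =
      (if k < 0 then {} else {\<omega> \<in> space (Pinf m). T \<omega> \<le> enat (nat k) \<and> d \<omega> = i})"
    proof (intro set_eqI)
      fix \<omega>
      show "\<omega> \<in> (\<Union>n\<in>{n. int (Suc n) \<le> k}. stopped_at d T (Suc n) i) \<longleftrightarrow>
        \<omega> \<in> (if k < 0 then {} else {\<omega> \<in> space (Pinf m). T \<omega> \<le> enat (nat k) \<and> d \<omega> = i})"
      proof (cases "T \<omega>")
        case (enat n)
        then show ?thesis using assms(2)[of \<omega>]
          by (cases n) (auto simp: stopped_at_def zero_enat_def)
      qed (auto simp: stopped_at_def)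
    qed
    then show "(if k < 0 then 0 else ennreal \<P>(\<omega> in Pinf m. T \<omega> \<le> enat (nat k) \<and> d \<omega> = i)) =
        (\<Sum>n. if int (Suc n) \<le> k then emeasure (Pinf m) (stopped_at d T (Suc n) i) else 0)"
      by (subst suminf_stopped_at[OF assms(1) refl]) (auto simp: P.emeasure_eq_measure)
  qed
  also have "\<dots> = (\<Sum>n. \<integral>\<^sup>+k. (if int (Suc n) \<le> k then emeasure (Pinf m) (stopped_at d T (Suc n) i) else 0)
      \<partial>measure_pmf (prior m))"
    by (intro nn_integral_suminf) simp
  also have "\<dots> = (\<Sum>n. \<integral>\<^sup>+k. emeasure (Pinf m) (stopped_at d T (Suc n) i) * indicator {int (Suc n)..} k
      \<partial>measure_pmf (prior m))"
    by (intro suminf_cong nn_integral_cong) (auto split: split_indicator)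
  also have "\<dots> = (\<Sum>n. ennreal (measure_pmf.prob (prior m) {int (Suc n)..}) *
      emeasure (Pinf m) (stopped_at d T (Suc n) i))"
    by (subst nn_integral_cmult_indicator) (simp_all add: measure_pmf.emeasure_eq_measure mult.commute)
  finally show ?thesis .
qed

lemma threshold_rule_di_rule: "threshold_rule m A (d, T) \<Longrightarrow> di_rule m (d, T)"
  by (simp add: threshold_rule_def)

text \<open>
  A finite infimum of natural numbers is attained, so at the alarm all statistics of the chosen
  stream have reached their thresholds.
\<close>

lemma threshold_rule_attained:
  assumes "threshold_rule m A (d, T)" "\<omega> \<in> stopped_at d T n i"
  shows "1 \<le> n" "\<And>j. j \<in> insert 0 (stream_ids m) - {i} \<Longrightarrow> ennreal (A i j) \<le> Lambar m i j n \<omega>"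
proof -
  let ?S = "{enat n | n. n \<ge> 1 \<and> (\<forall>j\<in>insert 0 (stream_ids m) - {i}. Lambar m i j n \<omega> \<ge> ennreal (A i j))}"
  have "T \<omega> = T_thr m A i \<omega>"
    using assms by (auto simp: threshold_rule_def stopped_at_def)
  then have Inf: "Inf ?S = enat n" using assms(2) by (auto simp: stopped_at_def T_thr_def)
  then have "?S \<noteq> {}" by (metis Inf_enat_def enat.distinct(1))
  then obtain x where "x \<in> ?S" by blast
  then have "Inf ?S \<in> ?S" by (rule wellorder_InfI)
  with Inf show "1 \<le> n" "\<And>j. j \<in> insert 0 (stream_ids m) - {i} \<Longrightarrow> ennreal (A i j) \<le> Lambar m i j n \<omega>"
    by auto
qed

lemma threshold_rule_nonzero:
  assumes "threshold_rule m A (d, T)" "\<omega> \<in> space (Pinf m)"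
  shows "T \<omega> \<noteq> 0"
proof
  assume "T \<omega> = 0"
  then have "\<omega> \<in> stopped_at d T 0 (d \<omega>)"
    using assms(2) by (simp add: stopped_at_def zero_enat_def)
  from threshold_rule_attained(1)[OF assms(1) this] show False by simp
qed

text \<open>
  At an alarm for \<open>i\<close>, \<open>P(\<nu> \<ge> n) \<le> Lam / A i 0\<close>. Integrated over these alarms and
  summed over \<open>n\<close>, this and \<open>stopped_Lam_le_no_false_alarm_prob\<close> give
  \<open>A i 0 * PFAi \<le> 1 - PFA \<le> 1 - PFAi\<close>, which is the claim solved for \<open>PFAi\<close>.
\<close>

lemma PFAi_threshold_rule_le:
  assumes rule: "threshold_rule m A (d, T)" and i: "i \<in> stream_ids m" and A: "0 < A i 0"
  shows "PFAi m (d, T) i \<le> 1 / (1 + A i 0)"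
proof -
  note di = threshold_rule_di_rule[OF rule]
  have i0: "0 \<in> insert 0 (stream_ids m) - {i}" using i by (auto simp: stream_ids_def)
  have "ennreal (A i 0 * PFAi m (d, T) i) = (\<Sum>n. ennreal (A i 0) *
      (ennreal (measure_pmf.prob (prior m) {int (Suc n)..}) * emeasure (Pinf m) (stopped_at d T (Suc n) i)))"
    using A PFAi_eq_suminf[OF di threshold_rule_nonzero[OF rule]]
    by (simp add: ennreal_mult' PFA_nonneg)
  also have "\<dots> \<le> (\<Sum>n. \<integral>\<^sup>+\<omega>. Lam m i (Suc n) \<omega> * indicator (stopped_at d T (Suc n) i) \<omega> \<partial>Pinf m)"
  proof (intro suminf_le)
    fix n
    have "ennreal (A i 0) * (ennreal (measure_pmf.prob (prior m) {int (Suc n)..}) *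
        emeasure (Pinf m) (stopped_at d T (Suc n) i)) =
      (\<integral>\<^sup>+\<omega>. (ennreal (A i 0) * ennreal (measure_pmf.prob (prior m) {int (Suc n)..})) *
        indicator (stopped_at d T (Suc n) i) \<omega> \<partial>Pinf m)"
      using stopped_at_sets_Pinf[OF di] by (subst nn_integral_cmult_indicator) (simp_all only: mult.assoc)
    also have "\<dots> \<le> (\<integral>\<^sup>+\<omega>. Lam m i (Suc n) \<omega> * indicator (stopped_at d T (Suc n) i) \<omega> \<partial>Pinf m)"
    proof (rule nn_integral_mono)
      fix \<omega>
      have "ennreal (A i 0) * ennreal (measure_pmf.prob (prior m) {int (Suc n)..}) \<le> Lam m i (Suc n) \<omega>"
        if "\<omega> \<in> stopped_at d T (Suc n) i"
        using threshold_rule_attained(2)[OF rule that i0] A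
        by (intro ennreal_divide_geD(2)) (simp_all add: Lambar_def)
      then show "ennreal (A i 0) * ennreal (measure_pmf.prob (prior m) {int (Suc n)..}) *
          indicator (stopped_at d T (Suc n) i) \<omega> \<le> Lam m i (Suc n) \<omega> * indicator (stopped_at d T (Suc n) i) \<omega>"
        by (auto split: split_indicator)
    qed
    finally show "ennreal (A i 0) * (ennreal (measure_pmf.prob (prior m) {int (Suc n)..}) *
        emeasure (Pinf m) (stopped_at d T (Suc n) i)) \<le>
      (\<integral>\<^sup>+\<omega>. Lam m i (Suc n) \<omega> * indicator (stopped_at d T (Suc n) i) \<omega> \<partial>Pinf m)" .
  qed auto
  also have "\<dots> \<le> no_false_alarm_prob T"
    by (rule stopped_Lam_le_no_false_alarm_prob[OF di i])
  finally have "A i 0 * PFAi m (d, T) i \<le> 1 - PFA m (d, T)"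
    using no_false_alarm_prob_eq[OF di] by simp
  also have "\<dots> \<le> 1 - PFAi m (d, T) i"
    using PFAi_le_PFA[OF di] by simp
  finally show ?thesis
    using A by (simp add: field_simps)
qed

section \<open>Misidentification\<close>

lemma sets_Ppi:
  "sets (Ppi m i \<theta>) = sets (Pinf m \<Otimes>\<^sub>M count_space UNIV)"
  unfolding Ppi_def by (rule sets_bind) (auto simp: measure_pmf.not_empty)

lemma space_Ppi: "space (Ppi m i \<theta>) = space (Pinf m) \<times> UNIV"
  using sets_eq_imp_space_eq[OF sets_Ppi] by (simp add: space_pair_measure)

lemma no_false_alarm_event:
  assumes "di_rule m (d, T)"
  shows "{z \<in> space (Ppi m i \<theta>). ereal (of_int (snd z)) < ereal_of_enat (T (fst z))} \<in> sets (Ppi m i \<theta>)" (is "?Z \<in> _")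
    and "i \<in> stream_ids m \<Longrightarrow> \<theta> \<in> Param m i \<Longrightarrow>
      emeasure (Ppi m i \<theta>) {z \<in> space (Ppi m i \<theta>). ereal (of_int (snd z)) < ereal_of_enat (T (fst z))} =
      no_false_alarm_prob T"
proof -
  have "?Z = (\<Union>k. alarm_after T k \<times> {k})"
    by (auto simp: space_Ppi alarm_after_def)
  moreover have "alarm_after T k \<times> {k} \<in> sets (Pinf m \<Otimes>\<^sub>M count_space UNIV)" for k :: int
    using Fn_subset_Pinf[OF alarm_after_sets_Fn[OF assms]] by (intro pair_measureI) auto
  ultimately show Z: "?Z \<in> sets (Ppi m i \<theta>)"
    unfolding sets_Ppi by (auto intro!: sets.countable_UN')
  assume i: "i \<in> stream_ids m" and \<theta>: "\<theta> \<in> Param m i"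
  have "(\<lambda>\<omega>. (\<omega>, k)) -` ?Z = alarm_after T k" for k
    by (auto simp: space_Ppi alarm_after_def)
  then show "emeasure (Ppi m i \<theta>) ?Z = no_false_alarm_prob T"
    unfolding no_false_alarm_prob_def
    using emeasure_Ppi[OF i \<theta> Z[unfolded sets_Ppi]]
      emeasure_Pch_Fn[OF i \<theta> order_refl alarm_after_sets_Fn[OF assms]]
    by simp
qed

definition decided_after_change ::
  "('w \<Rightarrow> nat) \<Rightarrow> ('w \<Rightarrow> enat) \<Rightarrow> nat \<Rightarrow> ('w \<times> int) set" where
  "decided_after_change d T j = {z \<in> space (Pinf m) \<times> UNIV.
     (d (fst z) = j \<and> T (fst z) < \<infinity>) \<and> ereal (of_int (snd z)) < ereal_of_enat (T (fst z))}"

lemma decided_after_change_section: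
  assumes "\<And>\<omega>. \<omega> \<in> space (Pinf m) \<Longrightarrow> T \<omega> \<noteq> 0"
  shows "(\<lambda>\<omega>. (\<omega>, k)) -` decided_after_change d T j =
    (\<Union>n\<in>{n. k < int (Suc n)}. stopped_at d T (Suc n) j)"
proof (intro set_eqI)
  fix \<omega>
  show "\<omega> \<in> (\<lambda>\<omega>. (\<omega>, k)) -` decided_after_change d T j \<longleftrightarrow>
      \<omega> \<in> (\<Union>n\<in>{n. k < int (Suc n)}. stopped_at d T (Suc n) j)"
  proof (cases "T \<omega>")
    case (enat n)
    have "real_of_int k < real n \<longleftrightarrow> k < int n" by linarith
    then show ?thesis using assms(1)[of \<omega>] enat
      by (cases n) (auto simp: stopped_at_def decided_after_change_def zero_enat_def)
  qed (auto simp: stopped_at_def decided_after_change_def)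
qed

lemma decided_after_change_sets:
  assumes "di_rule m (d, T)" "\<And>\<omega>. \<omega> \<in> space (Pinf m) \<Longrightarrow> T \<omega> \<noteq> 0"
  shows "decided_after_change d T j \<in> sets (Pinf m \<Otimes>\<^sub>M count_space UNIV)"
proof -
  have "decided_after_change d T j = (\<Union>k. ((\<lambda>\<omega>. (\<omega>, k)) -` decided_after_change d T j) \<times> {k})"
    by auto
  also have "\<dots> = (\<Union>k. (\<Union>n\<in>{n. k < int (Suc n)}. stopped_at d T (Suc n) j) \<times> {k})"
    by (simp only: decided_after_change_section[OF assms(2)])
  also have "\<dots> \<in> sets (Pinf m \<Otimes>\<^sub>M count_space UNIV)"
    using stopped_at_sets_Pinf[OF assms(1)]
    by (intro sets.countable_UN' pair_measureI) auto
  finally show ?thesis .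
qed

text \<open>
  The misidentification event has the law of stream \<open>i\<close>, while the estimate available for an alarm
  naming \<open>j\<close> concerns \<open>Lam\<close> of stream \<open>j\<close>. The threshold \<open>A j i\<close> connects them: at such an alarm the
  weighted likelihood ratios for every parameter of stream \<open>i\<close>, being bounded by their
  suprema, sum up to at most \<open>Lam / A j i\<close>. The same threshold keeps these ratios finite,
  so that they do account for the whole probability of the event.
\<close>

lemma decided_after_change_le:
  assumes rule: "threshold_rule m A (d, T)" and i: "i \<in> stream_ids m" and j: "j \<in> stream_ids m - {i}"
    and A: "0 < A j i" and \<theta>: "\<theta> \<in> Param m i"
  shows "ennreal (A j i) * emeasure (Ppi m i \<theta>) (decided_after_change d T j) \<le> no_false_alarm_prob T"
proof -
  note di = threshold_rule_di_rule[OF rule]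
  have ji: "i \<in> insert 0 (stream_ids m) - {j}" "i \<noteq> 0" using i j by (auto simp: stream_ids_def)
  define E where "E n = stopped_at d T (Suc n) j" for n
  have E: "E n \<in> sets (Fn m (Suc n))" "E n \<in> sets (Pinf m)" for n
    using stopped_at_sets_Fn[OF di] stopped_at_sets_Pinf[OF di] by (auto simp: E_def)
  have one: "ennreal (A j i) *
      (\<integral>\<^sup>+k. (if k < int (Suc n) then emeasure (Pch m (nat k) i \<theta>) (E n) else 0) \<partial>measure_pmf (prior m))
    \<le> (\<integral>\<^sup>+\<omega>. Lam m j (Suc n) \<omega> * indicator (E n) \<omega> \<partial>Pinf m)" for n
  proof -
    let ?K = "{-1..int (Suc n) - 1}"
    define D where "D \<omega> = (\<Sum>k\<in>?K. ennreal (pmf (prior m) k) * (SUP \<theta>\<in>Param m i. LR m i \<theta> k (Suc n) \<omega>))" for \<omega>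
    have "ennreal (A j i) \<le> Lam m j (Suc n) \<omega> / D \<omega>" if "\<omega> \<in> E n" for \<omega>
      using threshold_rule_attained(2)[OF rule that[unfolded E_def] ji(1)] ji(2)
      by (simp add: Lambar_def D_def)
    note D = ennreal_divide_geD[OF this A]
    have LR_le: "ennreal (pmf (prior m) k) * LR m i \<theta> k (Suc n) \<omega> \<le>
        ennreal (pmf (prior m) k) * (SUP \<theta>\<in>Param m i. LR m i \<theta> k (Suc n) \<omega>)" for k \<omega>
      using \<theta> by (intro mult_left_mono SUP_upper) auto
    have Pch_le: "ennreal (pmf (prior m) k) * emeasure (Pch m (nat k) i \<theta>) (E n) \<le>
        ennreal (pmf (prior m) k) * (\<integral>\<^sup>+\<omega>. LR m i \<theta> k (Suc n) \<omega> * indicator (E n) \<omega> \<partial>Pinf m)"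
      if k: "k \<in> ?K" for k
    proof (cases "pmf (prior m) k = 0")
      case False
      \<comment> \<open>An infinite ratio with positive weight would make the denominator \<open>D\<close> infinite.\<close>
      have "LR m i \<theta> k (Suc n) \<omega> \<noteq> \<top>" if "\<omega> \<in> E n" for \<omega>
      proof
        assume "LR m i \<theta> k (Suc n) \<omega> = \<top>"
        then have "\<top> = ennreal (pmf (prior m) k) * LR m i \<theta> k (Suc n) \<omega>"
          using False by (simp add: ennreal_mult_eq_top_iff pmf_pos)
        also have "\<dots> \<le> D \<omega>"
          unfolding D_def using k LR_le[of k \<omega>]
          by (intro order_trans[OF LR_le] member_le_sum) auto
        finally show False using D(1)[OF that] by (simp add: top_unique)
      qed
      then show ?thesis
        using k by (intro mult_left_mono Pch_le_nn_integral_LR[OF i \<theta> _ _ E(1)]) auto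
    qed simp
    have "(\<integral>\<^sup>+k. (if k < int (Suc n) then emeasure (Pch m (nat k) i \<theta>) (E n) else 0) \<partial>measure_pmf (prior m)) =
        (\<Sum>k\<in>?K. ennreal (pmf (prior m) k) * emeasure (Pch m (nat k) i \<theta>) (E n))"
      by (rule prior_sum_eq_nn_integral[symmetric])
    also have "\<dots> \<le> (\<Sum>k\<in>?K. ennreal (pmf (prior m) k) *
        (\<integral>\<^sup>+\<omega>. LR m i \<theta> k (Suc n) \<omega> * indicator (E n) \<omega> \<partial>Pinf m))"
      by (intro sum_mono Pch_le)
    also have "\<dots> = (\<Sum>k\<in>?K. \<integral>\<^sup>+\<omega>. ennreal (pmf (prior m) k) *
        (LR m i \<theta> k (Suc n) \<omega> * indicator (E n) \<omega>) \<partial>Pinf m)"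
      using LR_measurable[OF i \<theta>] E(2)
      by (intro sum.cong refl nn_integral_cmult[symmetric] borel_measurable_times_ennreal) auto
    also have "\<dots> = (\<integral>\<^sup>+\<omega>. (\<Sum>k\<in>?K. ennreal (pmf (prior m) k) *
        (LR m i \<theta> k (Suc n) \<omega> * indicator (E n) \<omega>)) \<partial>Pinf m)"
      using LR_measurable[OF i \<theta>] E(2)
      by (intro nn_integral_sum[symmetric] borel_measurable_times_ennreal) auto
    finally have "ennreal (A j i) *
        (\<integral>\<^sup>+k. (if k < int (Suc n) then emeasure (Pch m (nat k) i \<theta>) (E n) else 0) \<partial>measure_pmf (prior m)) \<le>
      ennreal (A j i) * (\<integral>\<^sup>+\<omega>. (\<Sum>k\<in>?K. ennreal (pmf (prior m) k) *
        (LR m i \<theta> k (Suc n) \<omega> * indicator (E n) \<omega>)) \<partial>Pinf m)"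
      by (rule mult_left_mono) simp
    also have "\<dots> = (\<integral>\<^sup>+\<omega>. ennreal (A j i) * (\<Sum>k\<in>?K. ennreal (pmf (prior m) k) *
        (LR m i \<theta> k (Suc n) \<omega> * indicator (E n) \<omega>)) \<partial>Pinf m)"
      using LR_measurable[OF i \<theta>] E(2)
      by (intro nn_integral_cmult[symmetric] borel_measurable_sum borel_measurable_times_ennreal) auto
    also have "\<dots> \<le> (\<integral>\<^sup>+\<omega>. Lam m j (Suc n) \<omega> * indicator (E n) \<omega> \<partial>Pinf m)"
    proof (rule nn_integral_mono)
      fix \<omega>
      show "ennreal (A j i) * (\<Sum>k\<in>?K. ennreal (pmf (prior m) k) * (LR m i \<theta> k (Suc n) \<omega> * indicator (E n) \<omega>))
        \<le> Lam m j (Suc n) \<omega> * indicator (E n) \<omega>"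
      proof (cases "\<omega> \<in> E n")
        case True
        have "ennreal (A j i) * (\<Sum>k\<in>?K. ennreal (pmf (prior m) k) * LR m i \<theta> k (Suc n) \<omega>)
            \<le> ennreal (A j i) * D \<omega>"
          unfolding D_def by (intro mult_left_mono sum_mono LR_le) simp
        also have "\<dots> \<le> Lam m j (Suc n) \<omega>" using True by (rule D(2))
        finally show ?thesis using True by simp
      qed simp
    qed
    finally show ?thesis .
  qed
  have "emeasure (Ppi m i \<theta>) (decided_after_change d T j) =
      (\<integral>\<^sup>+k. (\<Sum>n. if k < int (Suc n) then emeasure (Pch m (nat k) i \<theta>) (E n) else 0) \<partial>measure_pmf (prior m))"
    unfolding E_def
    by (simp only: suminf_stopped_at[OF di sets_Pch[OF i \<theta>]]
        emeasure_Ppi[OF i \<theta> decided_after_change_sets[OF di threshold_rule_nonzero[OF rule]]]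
        decided_after_change_section[OF threshold_rule_nonzero[OF rule]])
  also have "\<dots> = (\<Sum>n. \<integral>\<^sup>+k. (if k < int (Suc n) then emeasure (Pch m (nat k) i \<theta>) (E n) else 0)
      \<partial>measure_pmf (prior m))"
    by (rule nn_integral_suminf) simp
  finally have "ennreal (A j i) * emeasure (Ppi m i \<theta>) (decided_after_change d T j) =
      (\<Sum>n. ennreal (A j i) *
        (\<integral>\<^sup>+k. (if k < int (Suc n) then emeasure (Pch m (nat k) i \<theta>) (E n) else 0) \<partial>measure_pmf (prior m)))"
    by simp
  also have "\<dots> \<le> (\<Sum>n. \<integral>\<^sup>+\<omega>. Lam m j (Suc n) \<omega> * indicator (E n) \<omega> \<partial>Pinf m)"
    by (intro suminf_le one) auto
  also have "\<dots> \<le> no_false_alarm_prob T"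
    unfolding E_def using j by (intro stopped_Lam_le_no_false_alarm_prob[OF di]) simp
  finally show ?thesis .
qed

lemma measure_decided_after_change_le:
  assumes "threshold_rule m A (d, T)" "i \<in> stream_ids m" "j \<in> stream_ids m - {i}"
    "0 < A j i" "\<theta> \<in> Param m i"
  shows "measure (Ppi m i \<theta>) (decided_after_change d T j) \<le>
    1 / A j i * \<P>(z in Ppi m i \<theta>. ereal (of_int (snd z)) < ereal_of_enat (T (fst z)))"
proof -
  interpret prob_space "Ppi m i \<theta>" using assms(2,5) by (rule prob_space_Ppi)
  have "ennreal (A j i * measure (Ppi m i \<theta>) (decided_after_change d T j)) \<le>
      ennreal \<P>(z in Ppi m i \<theta>. ereal (of_int (snd z)) < ereal_of_enat (T (fst z)))"
    using decided_after_change_le[OF assms] assms(4)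
      no_false_alarm_event(2)[OF threshold_rule_di_rule[OF assms(1)] assms(2,5)]
    by (simp add: emeasure_eq_measure ennreal_mult')
  then show ?thesis
    using assms(4) by (simp add: field_simps)
qed

text \<open>
  The probability of \<open>T > \<nu>\<close> that bounds the misidentification event is also the one that is
  conditioned on, so it cancels. If it is zero the conditional probability is \<open>0\<close> by convention.
\<close>

lemma PMIij_threshold_rule_le:
  assumes rule: "threshold_rule m A (d, T)" and i: "i \<in> stream_ids m" and j: "j \<in> stream_ids m - {i}"
    and A: "0 < A j i"
  shows "PMIij m (d, T) i j \<le> 1 / A j i"
  unfolding PMIij_def prod.case
proof (rule cSUP_least[OF Param_nonempty[OF i]])
  fix \<theta> assume \<theta>: "\<theta> \<in> Param m i"
  show "\<P>(z in Ppi m i \<theta>. (d (fst z) = j \<and> T (fst z) < \<infinity>) \<bar>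
      (ereal_of_enat (T (fst z)) > ereal (of_int (snd z)))) \<le> 1 / A j i"
    using measure_decided_after_change_le[OF rule i j A \<theta>] A
    unfolding cond_prob_def decided_after_change_def space_Ppi
    by (simp add: divide_le_eq measure_le_0_iff zero_less_measure_iff)
qed

lemma PMIi_threshold_rule_le:
  assumes rule: "threshold_rule m A (d, T)" and i: "i \<in> stream_ids m"
    and A: "\<And>j. j \<in> stream_ids m - {i} \<Longrightarrow> 0 < A j i"
  shows "PMIi m (d, T) i \<le> (\<Sum>j\<in>stream_ids m - {i}. 1 / A j i)"
  unfolding PMIi_def prod.case
proof (rule cSUP_least[OF Param_nonempty[OF i]])
  fix \<theta> assume \<theta>: "\<theta> \<in> Param m i"
  interpret prob_space "Ppi m i \<theta>" using i \<theta> by (rule prob_space_Ppi)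
  note di = threshold_rule_di_rule[OF rule]
  let ?V = "\<P>(z in Ppi m i \<theta>. ereal (of_int (snd z)) < ereal_of_enat (T (fst z)))"
  have "{z \<in> space (Ppi m i \<theta>). (d (fst z) \<noteq> i \<and> T (fst z) < \<infinity>) \<and>
      ereal (of_int (snd z)) < ereal_of_enat (T (fst z))} =
    (\<Union>j\<in>stream_ids m - {i}. decided_after_change d T j)"
    using decision_in_streams[OF di] by (auto simp: space_Ppi decided_after_change_def)
  then have "\<P>(z in Ppi m i \<theta>. (d (fst z) \<noteq> i \<and> T (fst z) < \<infinity>) \<and>
      ereal (of_int (snd z)) < ereal_of_enat (T (fst z))) \<le>
    (\<Sum>j\<in>stream_ids m - {i}. prob (decided_after_change d T j))"
    using decided_after_change_sets[OF di threshold_rule_nonzero[OF rule]]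
    by (simp, intro finite_measure_subadditive_finite) (auto simp: sets_Ppi stream_ids_def)
  also have "\<dots> \<le> (\<Sum>j\<in>stream_ids m - {i}. 1 / A j i * ?V)"
    by (intro sum_mono measure_decided_after_change_le[OF rule i] A \<theta>)
  also have "\<dots> = (\<Sum>j\<in>stream_ids m - {i}. 1 / A j i) * ?V"
    by (rule sum_distrib_right[symmetric])
  finally show "\<P>(z in Ppi m i \<theta>. (d (fst z) \<noteq> i \<and> T (fst z) < \<infinity>) \<bar>
      (ereal_of_enat (T (fst z)) > ereal (of_int (snd z)))) \<le> (\<Sum>j\<in>stream_ids m - {i}. 1 / A j i)"
    using sum_nonneg[of "stream_ids m - {i}" "\<lambda>j. 1 / A j i"] A unfolding cond_prob_def
    by (cases "?V = 0") (simp_all add: divide_le_eq zero_less_measure_iff less_imp_le)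
qed

end

section \<open>Error bounds and choice of thresholds\<close>

theorem theorem1:
  fixes m :: "('w, 'x, 'e :: euclidean_space) cp_model"
    and A :: "nat \<Rightarrow> nat \<Rightarrow> real"
    and \<delta> :: "'w rule"
  assumes model: "changepoint_model m"
    and A_pos: "\<And>i j. i \<in> stream_ids m \<Longrightarrow> j \<in> insert 0 (stream_ids m) - {i} \<Longrightarrow> A i j > 0"
    and rule: "threshold_rule m A \<delta>"
  shows "(\<forall>i\<in>stream_ids m. PFAi m \<delta> i \<le> 1 / (1 + A i 0))
    \<and> PFA m \<delta> \<le> (\<Sum>i\<in>stream_ids m. 1 / (1 + A i 0))
    \<and> (\<forall>i\<in>stream_ids m. \<forall>j\<in>stream_ids m - {i}. PMIij m \<delta> i j \<le> (1 + A i 0) / (A i 0 * A j i))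
    \<and> (\<forall>i\<in>stream_ids m. PMIi m \<delta> i \<le> (1 + A i 0) / A i 0 * (\<Sum>j\<in>stream_ids m - {i}. 1 / A j i))
    \<and> (\<forall>\<alpha> \<beta>.
         (\<forall>i\<in>stream_ids m. 0 < \<alpha> i \<and> \<alpha> i < 1) \<longrightarrow>
         (\<forall>i\<in>stream_ids m. \<forall>j\<in>stream_ids m - {i}. 0 < \<beta> i j \<and> \<beta> i j < 1) \<longrightarrow>
         (MAX i\<in>stream_ids m. \<alpha> i) < 1 - pmf (prior m) (-1) \<longrightarrow>
         (\<forall>i\<in>stream_ids m. A i 0 = (1 - \<alpha> i) / \<alpha> i) \<longrightarrow>
         (\<forall>i\<in>stream_ids m. \<forall>j\<in>stream_ids m - {i}. A i j = 1 / ((1 - \<alpha> j) * \<beta> j i)) \<longrightarrow>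
         \<delta> \<in> rule_class m \<alpha> \<beta>)
    \<and> (\<forall>\<alpha> \<beta> A0 B.
         0 < \<alpha> \<and> \<alpha> < 1 \<longrightarrow>
         (\<forall>i\<in>stream_ids m. 0 < \<beta> i \<and> \<beta> i < 1) \<longrightarrow>
         (\<forall>i\<in>stream_ids m. A i 0 = A0) \<longrightarrow>
         (\<forall>i\<in>stream_ids m. \<forall>j\<in>stream_ids m - {i}. A i j = B j) \<longrightarrow>
         A0 = real (nstreams m) / \<alpha> * (1 - \<alpha> / real (nstreams m)) \<longrightarrow>
         (\<forall>j\<in>stream_ids m. B j = (real (nstreams m) - 1) / ((1 - \<alpha> / real (nstreams m)) * \<beta> j)) \<longrightarrow>
         \<delta> \<in> rule_class_star m \<alpha> \<beta>)"
proof -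
  interpret changepoint_model m by (rule model)
  obtain d T where \<delta>: "\<delta> = (d, T)" by (cases \<delta>)
  note rule' = rule[unfolded \<delta>]
  note di = threshold_rule_di_rule[OF rule']
  let ?S = "stream_ids m"
  have A0: "0 < A i 0" if "i \<in> ?S" for i
    using that by (intro A_pos) (auto simp: stream_ids_def)
  have Aji: "0 < A j i" if "i \<in> ?S" "j \<in> ?S - {i}" for i j
    using that by (intro A_pos) auto
  \<comment> \<open>This factor separates the bounds proved through \<open>1 / A j i\<close> from the larger asserted ones.\<close>
  have factor: "1 \<le> (1 + A i 0) / A i 0" if "i \<in> ?S" for i
    using A0[OF that] by (simp add: field_simps)
  have a: "PFAi m \<delta> i \<le> 1 / (1 + A i 0)" if "i \<in> ?S" for i
    unfolding \<delta> using PFAi_threshold_rule_le[OF rule' that A0[OF that]] .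
  have b: "PFA m \<delta> \<le> (\<Sum>i\<in>?S. 1 / (1 + A i 0))"
  proof -
    have "PFA m \<delta> = (\<Sum>i\<in>?S. PFAi m \<delta> i)"
      unfolding \<delta> using PFA_eq_sum_PFAi[OF di] threshold_rule_nonzero[OF rule'] by blast
    also have "\<dots> \<le> (\<Sum>i\<in>?S. 1 / (1 + A i 0))" by (intro sum_mono a)
    finally show ?thesis .
  qed
  have c: "PMIij m \<delta> i j \<le> (1 + A i 0) / (A i 0 * A j i)" if "i \<in> ?S" "j \<in> ?S - {i}" for i j
  proof -
    have "PMIij m \<delta> i j \<le> 1 * (1 / A j i)"
      unfolding \<delta> using PMIij_threshold_rule_le[OF rule' that Aji[OF that]] by simp
    also have "\<dots> \<le> (1 + A i 0) / A i 0 * (1 / A j i)"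
      using factor Aji that by (intro mult_right_mono) (auto simp: less_imp_le)
    finally show ?thesis by simp
  qed
  have e: "PMIi m \<delta> i \<le> (1 + A i 0) / A i 0 * (\<Sum>j\<in>?S - {i}. 1 / A j i)" if "i \<in> ?S" for i
  proof -
    have "PMIi m \<delta> i \<le> 1 * (\<Sum>j\<in>?S - {i}. 1 / A j i)"
      unfolding \<delta> using PMIi_threshold_rule_le[OF rule' that Aji[OF that]] by simp
    also have "\<dots> \<le> (1 + A i 0) / A i 0 * (\<Sum>j\<in>?S - {i}. 1 / A j i)"
      using factor Aji that by (intro mult_right_mono sum_nonneg) (auto simp: less_imp_le)
    finally show ?thesis .
  qed
  have f: "\<delta> \<in> rule_class m \<alpha> \<beta>"
    if \<alpha>: "\<forall>i\<in>?S. 0 < \<alpha> i \<and> \<alpha> i < 1"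
      and \<beta>: "\<forall>i\<in>?S. \<forall>j\<in>?S - {i}. 0 < \<beta> i j \<and> \<beta> i j < 1"
      and eq0: "\<forall>i\<in>?S. A i 0 = (1 - \<alpha> i) / \<alpha> i"
      and eq: "\<forall>i\<in>?S. \<forall>j\<in>?S - {i}. A i j = 1 / ((1 - \<alpha> j) * \<beta> j i)" for \<alpha> \<beta>
  proof -
    have "PFAi m \<delta> i \<le> \<alpha> i" if "i \<in> ?S" for i
      using a[OF that] \<alpha> eq0 that by (auto simp: field_simps)
    moreover have "PMIij m \<delta> i j \<le> \<beta> i j" if ij: "i \<in> ?S" "j \<in> ?S - {i}" for i j
    proof -
      have "0 < \<alpha> i" "\<alpha> i < 1" "0 < \<beta> i j" using \<alpha> \<beta> ij by auto
      then have "1 + (1 - \<alpha> i) / \<alpha> i = 1 / \<alpha> i"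
        and "(1 / \<alpha> i) / ((1 - \<alpha> i) / \<alpha> i * (1 / ((1 - \<alpha> i) * \<beta> i j))) = \<beta> i j"
        by (simp_all add: field_simps)
      moreover have "A i 0 = (1 - \<alpha> i) / \<alpha> i" "A j i = 1 / ((1 - \<alpha> i) * \<beta> i j)"
        using eq0 eq ij by auto
      ultimately have "(1 + A i 0) / (A i 0 * A j i) = \<beta> i j"
        by simp
      with c[OF ij] show ?thesis by simp
    qed
    ultimately show ?thesis
      using di by (simp add: rule_class_def \<delta>)
  qed
  have g: "\<delta> \<in> rule_class_star m \<alpha> \<beta>"
    if \<alpha>: "0 < \<alpha>" "\<alpha> < 1" and \<beta>: "\<forall>i\<in>?S. 0 < \<beta> i \<and> \<beta> i < 1"
      and eq0: "\<forall>i\<in>?S. A i 0 = real (nstreams m) / \<alpha> * (1 - \<alpha> / real (nstreams m))"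
      and eq: "\<forall>i\<in>?S. \<forall>j\<in>?S - {i}. A i j =
        (real (nstreams m) - 1) / ((1 - \<alpha> / real (nstreams m)) * \<beta> j)" for \<alpha> \<beta>
  proof -
    define N where "N = real (nstreams m)"
    have N: "2 \<le> N" using nstreams_ge2 by (simp add: N_def)
    have pos: "0 < N" "0 < \<alpha>" "0 < N - \<alpha>" using N \<alpha> by linarith+
    have card: "real (card ?S) = N" by (simp add: stream_ids_def N_def)
    \<comment> \<open>Hence \<open>1 / (1 + A i 0) = \<alpha> / N\<close>, so that the \<open>N\<close> false alarm bounds add up to \<open>\<alpha>\<close>.\<close>
    have A0_eq: "A i 0 = (N - \<alpha>) / \<alpha>" if "i \<in> ?S" for i
    proof -
      have "A i 0 = N / \<alpha> * (1 - \<alpha> / N)" using eq0 that unfolding N_def by blast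
      also have "\<dots> = (N - \<alpha>) / \<alpha>" using pos by (simp add: right_diff_distrib diff_divide_distrib)
      finally show ?thesis .
    qed
    have inv: "1 / (1 + (N - \<alpha>) / \<alpha>) = \<alpha> / N"
      using pos by (simp add: diff_divide_distrib)
    have "(\<Sum>i\<in>?S. 1 / (1 + A i 0)) = (\<Sum>i\<in>?S. \<alpha> / N)"
      by (intro sum.cong refl) (simp only: A0_eq inv)
    also have "\<dots> = \<alpha>" using N by (simp add: card)
    finally have "PFA m \<delta> \<le> \<alpha>" using b by simp
    moreover have "PMIi m \<delta> i \<le> \<beta> i" if i: "i \<in> ?S" for i
    proof -
      have \<beta>i: "0 < \<beta> i" using \<beta> i by auto
      have "1 / A j i = (1 - \<alpha> / N) * \<beta> i / (N - 1)" if "j \<in> ?S - {i}" for j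
        using eq i that by (simp add: N_def[symmetric])
      then have "(\<Sum>j\<in>?S - {i}. 1 / A j i) = (\<Sum>j\<in>?S - {i}. (1 - \<alpha> / N) * \<beta> i / (N - 1))"
        by simp
      also have "\<dots> = (N - 1) * ((1 - \<alpha> / N) * \<beta> i / (N - 1))"
      proof -
        have "real (card (?S - {i})) = N - 1"
          using i nstreams_ge2 by (simp add: stream_ids_def N_def of_nat_diff)
        then show ?thesis by simp
      qed
      also have "\<dots> = (1 - \<alpha> / N) * \<beta> i" using N by simp
      finally have sum: "(\<Sum>j\<in>?S - {i}. 1 / A j i) = (1 - \<alpha> / N) * \<beta> i" .
      have "1 + (N - \<alpha>) / \<alpha> = N / \<alpha>" "1 - \<alpha> / N = (N - \<alpha>) / N"
        using pos by (simp_all add: diff_divide_distrib)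
      then have "(1 + A i 0) / A i 0 * ((1 - \<alpha> / N) * \<beta> i) = \<beta> i"
        using pos by (simp add: A0_eq[OF i])
      then show ?thesis using e[OF i] by (simp only: sum)
    qed
    ultimately show ?thesis
      using di by (simp add: rule_class_star_def \<delta>)
  qed
  show ?thesis
  proof (intro conjI ballI allI impI)
    fix \<alpha> \<beta> A0 B
    assume \<alpha>: "0 < \<alpha> \<and> \<alpha> < 1" and \<beta>: "\<forall>i\<in>?S. 0 < \<beta> i \<and> \<beta> i < 1"
      and A0: "\<forall>i\<in>?S. A i 0 = A0" and B: "\<forall>i\<in>?S. \<forall>j\<in>?S - {i}. A i j = B j"
      and A0_eq: "A0 = real (nstreams m) / \<alpha> * (1 - \<alpha> / real (nstreams m))"
      and B_eq: "\<forall>j\<in>?S. B j = (real (nstreams m) - 1) / ((1 - \<alpha> / real (nstreams m)) * \<beta> j)"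
    show "\<delta> \<in> rule_class_star m \<alpha> \<beta>"
    proof (rule g)
      show "0 < \<alpha>" "\<alpha> < 1" using \<alpha> by simp_all
      show "\<forall>i\<in>?S. 0 < \<beta> i \<and> \<beta> i < 1" by (rule \<beta>)
      show "\<forall>i\<in>?S. A i 0 = real (nstreams m) / \<alpha> * (1 - \<alpha> / real (nstreams m))"
        using A0 unfolding A0_eq .
      show "\<forall>i\<in>?S. \<forall>j\<in>?S - {i}. A i j =
          (real (nstreams m) - 1) / ((1 - \<alpha> / real (nstreams m)) * \<beta> j)"
      proof (intro ballI)
        fix i j assume "i \<in> ?S" "j \<in> ?S - {i}"
        then have "A i j = B j" "j \<in> ?S" using B by blast+
        then show "A i j = (real (nstreams m) - 1) / ((1 - \<alpha> / real (nstreams m)) * \<beta> j)"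
          using bspec[OF B_eq] by simp
      qed
    qed
  qed (fact a, fact b, fact c, fact e, rule f)
qed

end
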